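(* Let $\varphi$ be an order-preserving, strongly mixing RDS on $H$ with ergodic measure $\mu$ concentrated on $V$. Then there exists a unique minimal weak point/interval random attractor $\mathcal A(\omega)=\{v(\omega)\}$ (i.e. $\mathcal A$ is both the unique minimal weak point random attractor and the unique minimal weak interval random attractor), given by a single random point $v:\Omega\to H$ with $v\in V$ $\mathbb{P}$-almost surely.
   Context: $(\Omega,\mathcal F,\mathbb{P},\{\theta_t\}_{t\in\mathbb{R}})$ is a metric dynamical system ($(t,\omega)\mapsto\theta_t\omega$ measurable, $\theta_0=\mathrm{id}$, $\theta_{t+s}=\theta_t\circ\theta_s$, each $\theta_t$ is $\mathbb{P}$-preserving). $H$ is a separable Hilbert space and $V\subseteq H$ a reflexive Banach space continuously and densely embedded in $H$. Order structure: $H_+\subseteq H$ is a cone, i.e. a closed convex set with $\lambda H_+\subseteq H_+$ for all $\lambda\ge0$ and $H_+\cap(-H_+)=\{0\}$; $V_+:=H_+\cap V$. Write $x\le y$ iff $y-x\in H_+$ and $[x,y]=\{z\in H: x\le z\le y\}$. It is assumed that: $V_+$ is $H$-solid, i.e. each compact set $K\subseteq V$ is contained in an interval $[x,y]\subseteq H$; $H_+$ is normal, i.e. there is $c>0$ with $\|x\|_H\le c\|y\|_H$ whenever $0\le x\le y$; and there is a map $x\mapsto x_+$ on $H$ with $x_+\ge x$ and $x_+\ge0$ for all $x\in H$. An RDS is a measurable map $\varphi:\mathbb{R}_+\times\Omega\times H\to H$ with $\varphi(0,\omega)=\mathrm{id}_H$ and $\varphi(t+s,\omega)=\varphi(t,\theta_s\omega)\circ\varphi(s,\omega)$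 for all $s,t\ge0$, $\omega\in\Omega$. It is strongly mixing with ergodic measure $\mu$ if the law $\mathcal L(\varphi(t;\cdot)x)$ converges to $\mu$ in total variation as $t\to\infty$ for all $x\in H$. It is order-preserving if $\varphi(t;\omega)x\le\varphi(t;\omega)y$ for all $x\le y$, $t\ge0$, $\omega\in\Omega$. Let $d(A,B)=\sup_{a\in A}\inf_{b\in B}\|a-b\|_H$. A random closed set $\{\mathcal A(\omega)\}_{\omega\in\Omega}$ ($\mathbb{P}$-a.s. closed, $\omega\mapsto d(x,\mathcal A(\omega))$ measurable for each $x\in H$) is a weak interval random attractor if (1) $\mathcal A(\omega)$ is nonempty and compact $\mathbb{P}$-a.s.; (2) for all $x\le y$ in $H$, $d(\varphi(t;\cdot)[x,y],\mathcal A(\theta_t\cdot))\to0$ in probability as $t\to\infty$ (equivalently $d(\varphi(t;\theta_{-t}\cdot)[x,y],\mathcal A(\cdot))\to0$ in probability); (3) $\varphi(t,\omega)\mathcal A(\omega)=\mathcal A(\theta_t\omega)$ $\mathbb{P}$-a.s. It is a weak point random attractor if (2) is replaced by $d(\varphi(t;\cdot)x,\mathcal A(\theta_t\cdot))\to0$ in probability for all $x\in H$. A weak interval (resp. point) random attractor $\mathcal A$ is minimal if $\mathcal A\subseteq\tilde{\mathcal A}$ $\mathbb{P}$-a.s. for each weak interval (resp. point) random attractor $\tilde{\mathcal A}$. Uniqueness is up to $\mathbb{P}$-null sets. *)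

theory Defs
  imports "HOL-Probability.Probability"
begin

section \<open>Ordered Hilbert spaces\<close>

definition cone_le :: "'h::real_vector set \<Rightarrow> 'h \<Rightarrow> 'h \<Rightarrow> bool" where
  "cone_le C x y \<longleftrightarrow> y - x \<in> C"

definition order_interval :: "'h::real_vector set \<Rightarrow> 'h \<Rightarrow> 'h \<Rightarrow> 'h set" where
  "order_interval C x y = {z. cone_le C x z \<and> cone_le C z y}"

definition order_cone :: "'h::real_normed_vector set \<Rightarrow> bool" where
  "order_cone C \<longleftrightarrow> closed C \<and> convex C \<and> cone C \<and> C \<inter> uminus ` C = {0}"

definition normal_cone :: "'h::real_normed_vector set \<Rightarrow> bool" where
  "normal_cone C \<longleftrightarrow>
     (\<exists>c>0. \<forall>x y. cone_le C 0 x \<and> cone_le C x y \<longrightarrow> norm x \<le> c * norm y)"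

definition reflexive_space :: "'v::real_normed_vector itself \<Rightarrow> bool" where
  "reflexive_space _ \<longleftrightarrow>
     (\<forall>F :: ('v \<Rightarrow>\<^sub>L real) \<Rightarrow>\<^sub>L real. \<exists>v. \<forall>f. blinfun_apply F f = blinfun_apply f v)"

text \<open>
  The inclusion of \<open>V\<close> into \<open>H\<close> is a map \<open>\<iota>\<close>, so that \<open>V\<close>, as a subset of \<open>H\<close>,
  is \<open>range \<iota>\<close>.  In the solidity assumption, compactness refers to the norm topology
  of \<open>V\<close>, whereas the end points of the interval are arbitrary points of \<open>H\<close>.
\<close>

locale ordered_hilbert_space =
  fixes C :: "'h::{real_inner, banach, second_countable_topology} set"
    and \<iota> :: "'v::banach \<Rightarrow> 'h"
  assumes reflexive_V: "reflexive_space TYPE('v)"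
    and continuous_embedding: "bounded_linear \<iota>" "inj \<iota>"
    and dense_embedding: "closure (range \<iota>) = UNIV"
    and order_cone: "order_cone C"
    and solid: "\<And>K. compact K \<Longrightarrow> \<exists>x y. \<iota> ` K \<subseteq> order_interval C x y"
    and normal: "normal_cone C"
    and positive_part: "\<exists>pos. \<forall>x. cone_le C x (pos x) \<and> cone_le C 0 (pos x)"

section \<open>Random dynamical systems\<close>

locale metric_dynamical_system = prob_space M
  for M :: "'w measure" +
  fixes \<theta> :: "real \<Rightarrow> 'w \<Rightarrow> 'w"
  assumes measurable_shift: "(\<lambda>(t, \<omega>). \<theta> t \<omega>) \<in> borel \<Otimes>\<^sub>M M \<rightarrow>\<^sub>M M"
    and shift_0: "\<And>\<omega>. \<omega> \<in> space M \<Longrightarrow> \<theta> 0 \<omega> = \<omega>"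
    and shift_add: "\<And>t s \<omega>. \<omega> \<in> space M \<Longrightarrow> \<theta> (t + s) \<omega> = \<theta> t (\<theta> s \<omega>)"
    and shift_preserving: "\<And>t. distr M M (\<theta> t) = M"

text \<open>Only the values \<open>\<phi> t\<close> with \<open>t \<ge> 0\<close> are meaningful.\<close>

locale random_dynamical_system = metric_dynamical_system M \<theta>
  for M :: "'w measure" and \<theta> :: "real \<Rightarrow> 'w \<Rightarrow> 'w" +
  fixes \<phi> :: "real \<Rightarrow> 'w \<Rightarrow> 'h::topological_space \<Rightarrow> 'h"
  assumes measurable_cocycle:
      "(\<lambda>(t, \<omega>, x). \<phi> t \<omega> x) \<in> restrict_space borel {0..} \<Otimes>\<^sub>M (M \<Otimes>\<^sub>M borel) \<rightarrow>\<^sub>M borel"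
    and cocycle_0: "\<And>\<omega>. \<omega> \<in> space M \<Longrightarrow> \<phi> 0 \<omega> = id"
    and cocycle_add: "\<And>t s \<omega>. t \<ge> 0 \<Longrightarrow> s \<ge> 0 \<Longrightarrow> \<omega> \<in> space M \<Longrightarrow>
      \<phi> (t + s) \<omega> = \<phi> t (\<theta> s \<omega>) \<circ> \<phi> s \<omega>"

definition order_preserving ::
  "'h::real_vector set \<Rightarrow> 'w measure \<Rightarrow> (real \<Rightarrow> 'w \<Rightarrow> 'h \<Rightarrow> 'h) \<Rightarrow> bool" where
  "order_preserving C M \<phi> \<longleftrightarrow>
     (\<forall>x y. \<forall>t\<ge>0. \<forall>\<omega>\<in>space M. cone_le C x y \<longrightarrow> cone_le C (\<phi> t \<omega> x) (\<phi> t \<omega> y))"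

text \<open>For probability measures on the same \<open>\<sigma>\<close>-algebra.\<close>

definition total_variation_dist :: "'a measure \<Rightarrow> 'a measure \<Rightarrow> real" where
  "total_variation_dist \<mu> \<nu> = (SUP A\<in>sets \<mu>. \<bar>measure \<mu> A - measure \<nu> A\<bar>)"

definition strongly_mixing ::
  "'w measure \<Rightarrow> (real \<Rightarrow> 'w \<Rightarrow> 'h::topological_space \<Rightarrow> 'h) \<Rightarrow> 'h measure \<Rightarrow> bool" where
  "strongly_mixing M \<phi> \<mu> \<longleftrightarrow> prob_space \<mu> \<and> sets \<mu> = sets borel \<and>
     (\<forall>x. ((\<lambda>t. total_variation_dist (distr M borel (\<lambda>\<omega>. \<phi> t \<omega> x)) \<mu>) \<longlongrightarrow> 0) at_top)"

section \<open>Weak random attractors\<close>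

text \<open>Values in \<open>ennreal\<close>: the distance of a nonempty set to the empty set is \<open>\<infinity>\<close>.\<close>

definition semidist :: "'h::metric_space set \<Rightarrow> 'h set \<Rightarrow> ennreal" where
  "semidist A B = (SUP a\<in>A. INF b\<in>B. ennreal (dist a b))"

text \<open>
  The functions below involve suprema over order intervals and need not be measurable
  with respect to \<open>M\<close> itself, hence the outer measure.  It agrees with \<open>emeasure M\<close>
  on \<open>sets M\<close>.
\<close>

definition tendsto_0_in_prob :: "'w measure \<Rightarrow> (real \<Rightarrow> 'w \<Rightarrow> ennreal) \<Rightarrow> bool" where
  "tendsto_0_in_prob M X \<longleftrightarrow>
     (\<forall>\<epsilon>>0. ((\<lambda>t. outer_measure_of M {\<omega>\<in>space M. X t \<omega> > ennreal \<epsilon>}) \<longlongrightarrow> 0) at_top)"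

definition random_closed_set :: "'w measure \<Rightarrow> ('w \<Rightarrow> 'h::metric_space set) \<Rightarrow> bool" where
  "random_closed_set M A \<longleftrightarrow> (AE \<omega> in M. closed (A \<omega>)) \<and>
     (\<forall>x. (\<lambda>\<omega>. semidist {x} (A \<omega>)) \<in> borel_measurable M)"

text \<open>
  In the invariance property the exceptional null set may depend on \<open>t\<close>.
\<close>

definition invariant_compact_random_set :: "'w measure \<Rightarrow> (real \<Rightarrow> 'w \<Rightarrow> 'w) \<Rightarrow>
    (real \<Rightarrow> 'w \<Rightarrow> 'h \<Rightarrow> 'h) \<Rightarrow> ('w \<Rightarrow> 'h::metric_space set) \<Rightarrow> bool" where
  "invariant_compact_random_set M \<theta> \<phi> A \<longleftrightarrow> random_closed_set M A \<and>
     (AE \<omega> in M. A \<omega> \<noteq> {} \<and> compact (A \<omega>)) \<and>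
     (\<forall>t\<ge>0. AE \<omega> in M. \<phi> t \<omega> ` A \<omega> = A (\<theta> t \<omega>))"

definition weak_point_attractor :: "'w measure \<Rightarrow> (real \<Rightarrow> 'w \<Rightarrow> 'w) \<Rightarrow>
    (real \<Rightarrow> 'w \<Rightarrow> 'h \<Rightarrow> 'h) \<Rightarrow> ('w \<Rightarrow> 'h::metric_space set) \<Rightarrow> bool" where
  "weak_point_attractor M \<theta> \<phi> A \<longleftrightarrow> invariant_compact_random_set M \<theta> \<phi> A \<and>
     (\<forall>x. tendsto_0_in_prob M (\<lambda>t \<omega>. semidist {\<phi> t \<omega> x} (A (\<theta> t \<omega>))))"

definition weak_interval_attractor :: "'h::real_normed_vector set \<Rightarrow> 'w measure \<Rightarrow>
    (real \<Rightarrow> 'w \<Rightarrow> 'w) \<Rightarrow> (real \<Rightarrow> 'w \<Rightarrow> 'h \<Rightarrow> 'h) \<Rightarrow> ('w \<Rightarrow> 'h set) \<Rightarrow> bool" where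
  "weak_interval_attractor C M \<theta> \<phi> A \<longleftrightarrow> invariant_compact_random_set M \<theta> \<phi> A \<and>
     (\<forall>x y. cone_le C x y \<longrightarrow>
        tendsto_0_in_prob M (\<lambda>t \<omega>. semidist (\<phi> t \<omega> ` order_interval C x y) (A (\<theta> t \<omega>))))"

text \<open>Minimality within a class \<open>Q\<close> of random sets.\<close>

definition minimal_random_set ::
  "'w measure \<Rightarrow> (('w \<Rightarrow> 'h set) \<Rightarrow> bool) \<Rightarrow> ('w \<Rightarrow> 'h set) \<Rightarrow> bool" where
  "minimal_random_set M Q A \<longleftrightarrow> Q A \<and> (\<forall>B. Q B \<longrightarrow> (AE \<omega> in M. A \<omega> \<subseteq> B \<omega>))"

definition unique_minimal_random_set ::
  "'w measure \<Rightarrow> (('w \<Rightarrow> 'h set) \<Rightarrow> bool) \<Rightarrow> ('w \<Rightarrow> 'h set) \<Rightarrow> bool" where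
  "unique_minimal_random_set M Q A \<longleftrightarrow> minimal_random_set M Q A \<and>
     (\<forall>B. minimal_random_set M Q B \<longrightarrow> (AE \<omega> in M. B \<omega> = A \<omega>))"

end

theory Submission
  imports Defs
begin

text \<open>Solidity makes the unit ball of \<open>V\<close> order bounded in \<open>H\<close>: otherwise suitably rescaled finite
  subsets of the ball would form a compact set that is not order bounded. Hence almost all of the
  mass of \<open>\<mu>\<close> lies in order intervals.

  For \<open>x \<le> y\<close> the laws of \<open>\<phi> t \<omega> x \<le> \<phi> t \<omega> y\<close> have the same limit \<open>\<mu>\<close>, so no up-set can separate the
  two trajectories with non-vanishing probability; by normality of the cone their distance tends
  to \<open>0\<close> in probability, and therefore so does the diameter of the image of every order interval.
  Since trajectories enter a large interval with probability close to one, the pullback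
  trajectories \<open>\<phi> t (\<theta> (- t) \<omega>) x\<close> are Cauchy in probability. Their limit \<open>v\<close>, which does not
  depend on \<open>x\<close>, is with probability close to one squeezed between two pullback trajectories, and
  this gives invariance without any continuity of \<open>\<phi>\<close>. Every point attractor contains the limits
  in probability of pullback trajectories, hence \<open>v\<close>.\<close>

section \<open>Decreasing sequences of closed convex sets in a Hilbert space\<close>

text \<open>The least norms \<open>d n\<close> increase to a finite limit, so by the parallelogram
  identity near-minimisers of the norm on \<open>U n\<close> form a Cauchy sequence, whose limit
  lies in every \<open>U n\<close>. It will yield one upper bound for infinitely many
  points.\<close>

lemma decseq_closed_convex_Inter_nonempty:
  fixes U :: "nat \<Rightarrow> 'h::{real_inner, complete_space} set"
  assumes closed: "\<And>n. closed (U n)" and convex: "\<And>n. convex (U n)" and dec: "decseq U"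
    and bounded: "\<And>n. \<exists>u\<in>U n. norm u \<le> R"
  shows "(\<Inter>n. U n) \<noteq> {}"
proof -
  define d where "d n = Inf (norm ` U n)" for n
  have ne: "norm ` U n \<noteq> {}" for n using bounded[of n] by auto
  have bdd: "bdd_below (norm ` U n)" for n by (rule bdd_belowI[of _ 0]) auto
  have d_le: "d n \<le> norm u" if "u \<in> U n" for n u
    unfolding d_def using that bdd by (auto intro: cInf_lower)
  have d0: "0 \<le> d n" for n unfolding d_def using ne by (intro cInf_greatest) auto
  have "incseq d"
    unfolding d_def using dec ne bdd
    by (intro monoI cInf_superset_mono image_mono) (auto simp: decseq_def)
  moreover have "d n \<le> R" for n using bounded[of n] d_le by force
  ultimately obtain D where D: "d \<longlonglongrightarrow> D" using incseq_convergent[of d R] by metis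
  have "\<exists>u\<in>U n. norm u \<le> d n + inverse (real (Suc n))" for n
    using cInf_lessD[OF ne, of n "d n + inverse (real (Suc n))"]
    unfolding d_def[symmetric] by (force intro: less_imp_le)
  then obtain u where u: "\<And>n. u n \<in> U n" "\<And>n. norm (u n) \<le> d n + inverse (real (Suc n))"
    by metis
  define g where "g n = (d n + inverse (real (Suc n)))\<^sup>2" for n
  have g: "g \<longlonglongrightarrow> D\<^sup>2"
    unfolding g_def by (rule tendsto_eq_intros D LIMSEQ_inverse_real_of_nat refl | simp)+
  have d2: "(\<lambda>n. (d n)\<^sup>2) \<longlonglongrightarrow> D\<^sup>2" by (intro tendsto_intros D)
  \<comment> \<open>By convexity the midpoint of \<open>u m\<close> and \<open>u n\<close> stays in
    the larger set \<open>U n\<close>, so its norm is at least \<open>d n\<close>. The right-hand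
    side vanishes in the limit because \<open>g\<close> and the squares of \<open>d\<close> both
    tend to the square of \<open>D\<close>.\<close>
  have par: "(norm (u m - u n))\<^sup>2 \<le> 2 * g m + 2 * g n - 4 * (d n)\<^sup>2" if "n \<le> m" for m n
  proof -
    have "u m \<in> U n" using u(1)[of m] dec that by (auto simp: decseq_def)
    then have "(1/2) *\<^sub>R u m + (1/2) *\<^sub>R u n \<in> U n"
      using convexD[OF convex[of n], of "u m" "u n" "1/2" "1/2"] u(1)[of n] by simp
    then have "d n \<le> norm ((1/2) *\<^sub>R u m + (1/2) *\<^sub>R u n)" by (rule d_le)
    also have "(1/2) *\<^sub>R u m + (1/2) *\<^sub>R u n = (1/2) *\<^sub>R (u m + u n)"
      by (simp add: scaleR_add_right)
    finally have "2 * d n \<le> norm (u m + u n)" by simp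
    then have "(2 * d n)\<^sup>2 \<le> (norm (u m + u n))\<^sup>2" using d0[of n] by (intro power_mono) auto
    moreover have "(norm (u m))\<^sup>2 \<le> g m" "(norm (u n))\<^sup>2 \<le> g n"
      unfolding g_def using u(2) by (auto intro!: power_mono)
    moreover have "(norm (u m - u n))\<^sup>2 + (norm (u m + u n))\<^sup>2 = 2 * (norm (u m))\<^sup>2 + 2 * (norm (u n))\<^sup>2"
      by (simp add: power2_norm_eq_inner inner_simps inner_commute)
    ultimately show ?thesis by (simp add: power_mult_distrib)
  qed
  have "Cauchy u"
  proof (rule CauchyI')
    fix e :: real assume "0 < e"
    then have e: "0 < e\<^sup>2 / 8" by simp
    \<comment> \<open>The denominator 8 is the sum of the coefficients 2, 2 and 4 in
      \<open>par\<close>.\<close>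
    have "\<forall>\<^sub>F n in sequentially. dist (g n) (D\<^sup>2) < e\<^sup>2 / 8 \<and> dist ((d n)\<^sup>2) (D\<^sup>2) < e\<^sup>2 / 8"
      using tendstoD[OF g e] tendstoD[OF d2 e] by (rule eventually_conj)
    then obtain N where N: "\<And>n. n \<ge> N \<Longrightarrow> dist (g n) (D\<^sup>2) < e\<^sup>2 / 8 \<and> dist ((d n)\<^sup>2) (D\<^sup>2) < e\<^sup>2 / 8"
      by (auto simp: eventually_sequentially)
    have "dist (u m) (u n) < e" if "m \<ge> N" "n > m" for m n
    proof -
      have "(norm (u n - u m))\<^sup>2 < e\<^sup>2"
        using par[of m n] N[of m] N[of n] that unfolding dist_real_def by linarith
      then show ?thesis
        using \<open>0 < e\<close> by (metis dist_commute dist_norm less_imp_le power_less_imp_less_base)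
    qed
    then show "\<exists>M. \<forall>m\<ge>M. \<forall>n>m. dist (u m) (u n) < e" by auto
  qed
  then obtain l where l: "u \<longlonglongrightarrow> l" using Cauchy_convergent convergent_def by blast
  have "l \<in> U n" for n
  proof (rule Lim_in_closed_set[OF closed _ _ l])
    show "\<forall>\<^sub>F m in sequentially. u m \<in> U n"
      using u(1) dec unfolding decseq_def eventually_sequentially by blast
  qed simp
  then show ?thesis by auto
qed

text \<open>In any open cover, a member containing 0 already swallows a ball around 0, and only
  finitely many points of \<open>K\<close> remain.\<close>

lemma compact_insert_0_null_family:
  fixes K :: "'v::real_normed_vector set"
  assumes "0 \<in> K" and fin: "\<And>e. e > 0 \<Longrightarrow> finite (K - ball 0 e)"
  shows "compact K"
  unfolding compact_eq_Heine_Borel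
proof (intro allI impI, elim conjE)
  fix \<U> :: "'v set set" assume op: "\<forall>T\<in>\<U>. open T" and cov: "K \<subseteq> \<Union>\<U>"
  then obtain T where T: "T \<in> \<U>" "0 \<in> T" using assms(1) by auto
  then obtain e where e: "e > 0" "ball 0 e \<subseteq> T" using op by (meson open_contains_ball)
  have "compact (K - ball 0 e)" using fin[OF e(1)] by (rule finite_imp_compact)
  then obtain \<V> where "\<V> \<subseteq> \<U>" "finite \<V>" "K - ball 0 e \<subseteq> \<Union>\<V>"
    using op cov by (meson compactE Diff_subset order_trans)
  then show "\<exists>\<V>\<subseteq>\<U>. finite \<V> \<and> K \<subseteq> \<Union>\<V>"
    using T e by (intro exI[of _ "insert T \<V>"]) auto
qed

section \<open>Order cones\<close>

locale normal_ordered_space =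
  fixes C :: "'h::real_normed_vector set"
  assumes order_cone: "order_cone C" and normal: "normal_cone C"
    and positive_part: "\<exists>pos. \<forall>x. cone_le C x (pos x) \<and> cone_le C 0 (pos x)"
begin

abbreviation le (infix "\<preceq>" 50) where "x \<preceq> y \<equiv> cone_le C x y"
abbreviation interval where "interval \<equiv> order_interval C"

lemma closed_C: "closed C" and zero_in_C: "0 \<in> C"
  using order_cone unfolding order_cone_def by auto

lemma C_add: "x \<in> C \<Longrightarrow> y \<in> C \<Longrightarrow> x + y \<in> C"
  using order_cone convex_cone unfolding order_cone_def by blast

lemma C_scaleR: "x \<in> C \<Longrightarrow> 0 \<le> c \<Longrightarrow> c *\<^sub>R x \<in> C"
  using order_cone unfolding order_cone_def cone_def by blast

lemma le_refl: "x \<preceq> x"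
  by (simp add: cone_le_def zero_in_C)

lemma le_trans: "x \<preceq> y \<Longrightarrow> y \<preceq> z \<Longrightarrow> x \<preceq> z"
  using C_add[of "y - x" "z - y"] by (simp add: cone_le_def)

lemma le_antisym: 
  assumes "x \<preceq> y" "y \<preceq> x" shows "x = y"
proof -
  have "y - x \<in> C \<inter> uminus ` C"
    using assms by (auto simp: cone_le_def intro!: image_eqI[of _ _ "x - y"])
  then show ?thesis using order_cone unfolding order_cone_def by auto
qed

lemma interval_same: "interval x x = {x}"
  using le_antisym le_refl by (auto simp: order_interval_def)

lemma interval_iff: "z \<in> interval x y \<longleftrightarrow> x \<preceq> z \<and> z \<preceq> y"
  by (simp add: order_interval_def)

lemma interval_mono: "a' \<preceq> a \<Longrightarrow> b \<preceq> b' \<Longrightarrow> interval a b \<subseteq> interval a' b'"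
  using le_trans by (auto simp: interval_iff)

lemma closed_up: "closed {z. x \<preceq> z}" and closed_down: "closed {z. z \<preceq> x}"
proof -
  have "closed ((\<lambda>z. z - x) -` C)" "closed ((\<lambda>z. x - z) -` C)"
    by (intro closed_vimage[OF closed_C] continuous_intros)+
  then show "closed {z. x \<preceq> z}" "closed {z. z \<preceq> x}"
    by (simp_all only: cone_le_def vimage_def)
qed

lemma closed_interval: "closed (interval x y)"
  unfolding order_interval_def using closed_Int[OF closed_up closed_down]
  by (simp add: Collect_conj_eq)

text \<open>Adding \<open>x\<close> to the positive part of \<open>y - x\<close> works. Common upper
  bounds link trajectories whose starting points are not comparable.\<close>

lemma upper_bound: obtains z where "x \<preceq> z" "y \<preceq> z"
proof -
  obtain p where "cone_le C (y - x) p" "cone_le C 0 p" using positive_part by blast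
  then show thesis by (intro that[of "x + p"]) (auto simp: cone_le_def algebra_simps)
qed

definition nc :: real where
  "nc = (SOME c. c > 0 \<and> (\<forall>x y. 0 \<preceq> x \<and> x \<preceq> y \<longrightarrow> norm x \<le> c * norm y))"

lemma nc: "nc > 0" and norm_le_nc: "0 \<preceq> x \<Longrightarrow> x \<preceq> y \<Longrightarrow> norm x \<le> nc * norm y"
proof -
  have "nc > 0 \<and> (\<forall>x y. 0 \<preceq> x \<and> x \<preceq> y \<longrightarrow> norm x \<le> nc * norm y)"
    unfolding nc_def by (rule someI_ex) (rule normal[unfolded normal_cone_def])
  then show "nc > 0" "0 \<preceq> x \<Longrightarrow> x \<preceq> y \<Longrightarrow> norm x \<le> nc * norm y" by blast+
qed

text \<open>Normality applied to \<open>z - a\<close> and \<open>b - a\<close>: order intervals with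
  close end points have small diameter.\<close>

lemma dist_interval_le:
  assumes "z \<in> interval a b" shows "dist z a \<le> nc * dist a b"
  using norm_le_nc[of "z - a" "b - a"] assms
  by (auto simp: interval_iff cone_le_def dist_norm norm_minus_commute)

text \<open>A continuous, order-monotone gauge of how far \<open>z\<close> is from lying below
  \<open>w\<close>. Its sublevel sets are closed and downward closed, and serve as test sets for
  comparing the laws of two ordered trajectories.\<close>

definition below_dist :: "'h \<Rightarrow> 'h \<Rightarrow> real" where
  "below_dist w z = infdist z {u. u \<preceq> w}"

lemma continuous_below_dist: "continuous_on UNIV (below_dist w)"
  unfolding below_dist_def by (intro continuous_intros)

text \<open>Lowering a point \<open>u\<close> below \<open>w\<close> by \<open>y - x\<close> keeps
  it below \<open>w\<close>, and its distance to \<open>x\<close> is then the distance from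
  \<open>u\<close> to \<open>y\<close>.\<close>

lemma below_dist_mono:
  assumes "x \<preceq> y" shows "below_dist w x \<le> below_dist w y"
proof -
  have ne: "{u. u \<preceq> w} \<noteq> {}" using le_refl by auto
  have "infdist x {u. u \<preceq> w} \<le> dist y u" if "u \<preceq> w" for u
  proof -
    have "u - (y - x) \<preceq> w"
      using that assms C_add[of "w - u" "y - x"] by (simp add: cone_le_def algebra_simps)
    then have "infdist x {u. u \<preceq> w} \<le> dist x (u - (y - x))"
      by (intro infdist_le) auto
    then show ?thesis by (simp add: dist_norm algebra_simps)
  qed
  then show ?thesis
    unfolding below_dist_def infdist_notempty[OF ne, of y] using ne by (intro cINF_greatest) auto
qed

lemma below_dist_le: "below_dist w x \<le> dist x w"
  unfolding below_dist_def by (intro infdist_le) (auto simp: le_refl)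

text \<open>For \<open>u\<close> below \<open>w\<close>, normality compares \<open>y - x\<close>
  with \<open>(y - x) + (w - u)\<close>, which equals \<open>(y - u) - (x - w)\<close>. Thus if
  \<open>x\<close> is near \<open>w\<close> and the larger point \<open>y\<close> is nearly below
  \<open>w\<close>, then \<open>x\<close> and \<open>y\<close> are close.\<close>

lemma below_dist_ge:
  assumes "x \<preceq> y" shows "dist x y \<le> nc * (below_dist w y + dist x w)"
proof -
  have ne: "{u. u \<preceq> w} \<noteq> {}" using le_refl by auto
  have "dist x y / nc - dist x w \<le> dist y u" if "u \<preceq> w" for u
  proof -
    have "norm (y - x) \<le> nc * norm (y - x + (w - u))"
      using that assms by (intro norm_le_nc) (auto simp: cone_le_def)
    then have "norm (y - x) / nc \<le> norm (y - u - (x - w))"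
      using nc by (simp add: field_simps)
    also have "\<dots> \<le> norm (y - u) + norm (x - w)" by (rule norm_triangle_ineq4)
    finally show ?thesis by (simp add: dist_norm norm_minus_commute)
  qed
  then have "dist x y / nc - dist x w \<le> below_dist w y"
    unfolding below_dist_def infdist_notempty[OF ne, of y] using ne by (intro cINF_greatest) auto
  then show ?thesis using nc by (simp add: field_simps)
qed

end

section \<open>Order boundedness of balls of V and the mass of order intervals\<close>

context ordered_hilbert_space
begin

sublocale normal_ordered_space C
  by unfold_locales (fact order_cone normal positive_part)+

text \<open>\<open>U n\<close> collects the common upper bounds of the first points of a sequence
  dense in the image of the ball. If every \<open>U n\<close> meets one fixed norm ball, the
  intersection lemma gives a bound for the whole sequence; otherwise solidity is contradicted by a
  compact set of rescaled points.\<close>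

lemma unit_ball_order_bounded:
  obtains y where "\<And>v. norm v \<le> 1 \<Longrightarrow> \<iota> v \<preceq> y"
proof -
  interpret \<iota>: bounded_linear \<iota> by (rule continuous_embedding)
  obtain D where D: "countable D" "D \<subseteq> \<iota> ` cball 0 1" "\<iota> ` cball 0 1 \<subseteq> closure D"
    using separable by blast
  have "D \<noteq> {}" using D(3) by force
  then have D_range: "range (from_nat_into D) = D" using D(1) by (simp add: range_from_nat_into)
  have "from_nat_into D k \<in> \<iota> ` cball 0 1" for k
    using D(2) from_nat_into[OF \<open>D \<noteq> {}\<close>, of k] by blast
  then have "\<exists>v. norm v \<le> 1 \<and> from_nat_into D k = \<iota> v" for k
    by (metis imageE mem_cball_0)
  then obtain v where v: "\<And>k. norm (v k) \<le> 1" "\<And>k. from_nat_into D k = \<iota> (v k)" by metis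
  then have range: "range (\<lambda>k. \<iota> (v k)) = D" using D_range by simp
  define U where "U n = {u. \<forall>k\<le>n. \<iota> (v k) \<preceq> u}" for n :: nat
  have U_Inter: "U n = (\<Inter>k\<in>{..n}. {u. \<iota> (v k) \<preceq> u})" for n by (auto simp: U_def)
  have conv: "convex {u. x \<preceq> u}" for x
  proof -
    have "{u. x \<preceq> u} = (\<lambda>c. x + c) ` C"
      by (auto simp: cone_le_def intro!: image_eqI[where x = "_ - x"])
    then show ?thesis using order_cone unfolding order_cone_def by (simp add: convex_translation)
  qed
  have "\<exists>R. \<forall>n. \<exists>u\<in>U n. norm u \<le> R"
  proof (rule ccontr)
    assume "\<not> ?thesis"
    \<comment> \<open>The square outgrows the factor \<open>Suc m\<close> lost in undoing the
      rescaling by \<open>inverse (real (Suc m))\<close> below.\<close>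
    then have "\<forall>m. \<exists>n. \<forall>u\<in>U n. norm u > (real (Suc m))\<^sup>2" by (meson not_less)
    then obtain N where N: "\<And>m u. u \<in> U (N m) \<Longrightarrow> norm u > (real (Suc m))\<^sup>2" by metis
    \<comment> \<open>Block \<open>m\<close> is finite and has norm at most
      \<open>inverse (real (Suc m))\<close>, so outside any ball around 0 only finitely many points
      remain.\<close>
    define K where "K = insert 0 (\<Union>m. (\<lambda>k. inverse (real (Suc m)) *\<^sub>R v k) ` {..N m})"
    have "compact K"
    proof (rule compact_insert_0_null_family)
      fix e :: real assume "e > 0"
      then obtain m0 where m0: "inverse (real (Suc m0)) < e"
        using reals_Archimedean by blast
      have "K - ball 0 e \<subseteq> (\<Union>m<m0. (\<lambda>k. inverse (real (Suc m)) *\<^sub>R v k) ` {..N m})"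
      proof
        fix x assume x: "x \<in> K - ball 0 e"
        then obtain m k where mk: "k \<le> N m" "x = inverse (real (Suc m)) *\<^sub>R v k"
          using \<open>e > 0\<close> by (auto simp: K_def)
        have "m < m0"
        proof (rule ccontr)
          assume "\<not> m < m0"
          then have "inverse (real (Suc m)) \<le> inverse (real (Suc m0))"
            by (intro le_imp_inverse_le) auto
          moreover have "norm x = inverse (real (Suc m)) * norm (v k)" by (simp add: mk)
          moreover have "inverse (real (Suc m)) * norm (v k) \<le> inverse (real (Suc m)) * 1"
            using v(1) by (intro mult_left_mono) auto
          ultimately have "norm x < e" using m0 by linarith
          then show False using x by simp
        qed
        then show "x \<in> (\<Union>m<m0. (\<lambda>k. inverse (real (Suc m)) *\<^sub>R v k) ` {..N m})"
          using mk by auto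
      qed
      then show "finite (K - ball 0 e)" by (rule finite_subset) auto
    qed (simp add: K_def)
    then obtain x y where xy: "\<iota> ` K \<subseteq> interval x y" using solid by blast
    have "real (Suc m) < norm y" for m
    proof -
      \<comment> \<open>Scaling the order bound \<open>y\<close> of \<open>K\<close> back up bounds
        the unscaled block \<open>m\<close>, although all elements of \<open>U (N m)\<close> have
        norm above the square of \<open>Suc m\<close>.\<close>
      have "real (Suc m) *\<^sub>R y \<in> U (N m)"
        unfolding U_def
      proof safe
        fix k assume "k \<le> N m"
        then have "\<iota> (inverse (real (Suc m)) *\<^sub>R v k) \<preceq> y"
          using xy by (auto simp: K_def interval_iff subset_iff image_iff)
        then have "real (Suc m) *\<^sub>R (y - \<iota> (inverse (real (Suc m)) *\<^sub>R v k)) \<in> C"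
          unfolding cone_le_def by (rule C_scaleR) simp
        then show "\<iota> (v k) \<preceq> real (Suc m) *\<^sub>R y"
          by (simp add: cone_le_def \<iota>.scaleR scaleR_diff_right)
      qed
      then have "(real (Suc m))\<^sup>2 < real (Suc m) * norm y" using N by fastforce
      then show ?thesis by (simp add: power2_eq_square)
    qed
    moreover obtain m where "norm y < real m" using reals_Archimedean2 by blast
    ultimately have "real (Suc m) < real m" by (meson less_trans)
    then show False by simp
  qed
  then obtain R where R: "\<And>n. \<exists>u\<in>U n. norm u \<le> R" by blast
  have "(\<Inter>n. U n) \<noteq> {}"
  proof (rule decseq_closed_convex_Inter_nonempty[OF _ _ _ R])
    show "closed (U n)" "convex (U n)" for n
      unfolding U_Inter using closed_up conv by (auto intro!: closed_INT convex_INT)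
    show "decseq U" by (auto simp: U_def decseq_def)
  qed
  then obtain y where "\<And>k. \<iota> (v k) \<preceq> y" by (auto simp: U_def)
  then have "D \<subseteq> {z. z \<preceq> y}" using range by auto
  \<comment> \<open>The bound passes from the dense sequence to the whole image of the ball because
    the set of points below \<open>y\<close> is closed.\<close>
  then have "closure D \<subseteq> {z. z \<preceq> y}" by (rule closure_minimal) (rule closed_down)
  then show thesis using D(3) by (intro that[of y]) (auto simp: subset_iff)
qed

text \<open>Multiples of the bound \<open>y\<close> for the unit ball bound the larger balls from
  above, and from below through \<open>- v\<close>. The intervals increase since \<open>y\<close>
  also bounds the image of 0 and is therefore positive.\<close>

lemma range_subset_UN_interval:
  obtains a b where "range \<iota> \<subseteq> (\<Union>n. interval (a n) (b n))"
    "incseq (\<lambda>n. interval (a n) (b n))"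
proof -
  interpret \<iota>: bounded_linear \<iota> by (rule continuous_embedding)
  obtain y where y: "\<And>v. norm v \<le> 1 \<Longrightarrow> \<iota> v \<preceq> y" using unit_ball_order_bounded by blast
  have le: "\<iota> v \<preceq> real (Suc n) *\<^sub>R y" if "norm v \<le> real (Suc n)" for v n
  proof -
    have "\<iota> (inverse (real (Suc n)) *\<^sub>R v) \<preceq> y"
      using that by (intro y) (simp add: field_simps)
    then have "real (Suc n) *\<^sub>R (y - \<iota> (inverse (real (Suc n)) *\<^sub>R v)) \<in> C"
      unfolding cone_le_def by (rule C_scaleR) simp
    then show ?thesis by (simp add: cone_le_def \<iota>.scaleR scaleR_diff_right)
  qed
  let ?I = "\<lambda>n. interval (- (real (Suc n) *\<^sub>R y)) (real (Suc n) *\<^sub>R y)"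
  have I: "\<iota> v \<in> ?I n" if "norm v \<le> real (Suc n)" for v n
    using le[of v n] le[of "- v" n] that by (simp add: interval_iff cone_le_def linear_neg[OF \<iota>.linear] add.commute)
  have "range \<iota> \<subseteq> (\<Union>n. ?I n)"
  proof
    fix z assume "z \<in> range \<iota>"
    then obtain v where v: "z = \<iota> v" by auto
    obtain n where "norm v \<le> real n" using real_arch_simple by blast
    then show "z \<in> (\<Union>n. ?I n)" using I[of v n] v by auto
  qed
  moreover have "incseq ?I"
  proof (rule incseq_SucI, rule interval_mono)
    fix n
    have "y \<in> C" using y[of 0] by (simp add: cone_le_def \<iota>.zero)
    then show "real (Suc n) *\<^sub>R y \<preceq> real (Suc (Suc n)) *\<^sub>R y"
      by (simp add: cone_le_def flip: scaleR_diff_left)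
    then show "- (real (Suc (Suc n)) *\<^sub>R y) \<preceq> - (real (Suc n) *\<^sub>R y)"
      by (simp add: cone_le_def)
  qed
  ultimately show thesis by (rule that)
qed

text \<open>Continuity from below along closed, hence Borel, intervals that exhaust the image of
  V.\<close>

lemma interval_mass:
  assumes "prob_space \<mu>" "sets \<mu> = sets borel" "AE x in \<mu>. x \<in> range \<iota>" "e > 0"
  shows "\<exists>a b. measure \<mu> (interval a b) > 1 - e"
proof -
  interpret prob_space \<mu> by fact
  obtain a b where ab: "range \<iota> \<subseteq> (\<Union>n. interval (a n) (b n))" "incseq (\<lambda>n. interval (a n) (b n))"
    using range_subset_UN_interval by blast
  let ?I = "\<lambda>n. interval (a n) (b n)"
  have sets: "?I n \<in> events" for n by (simp add: assms(2) closed_interval borel_closed)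
  have "AE x in \<mu>. x \<in> (\<Union>n. ?I n)" using assms(3) ab(1) by (auto elim!: eventually_mono)
  then have "prob (\<Union>n. ?I n) = 1" using sets by (subst prob_eq_1) auto
  moreover have "(\<lambda>n. prob (?I n)) \<longlonglongrightarrow> prob (\<Union>n. ?I n)"
    using sets ab(2) by (intro finite_Lim_measure_incseq) auto
  ultimately have "\<forall>\<^sub>F n in sequentially. prob (?I n) > 1 - e"
    using \<open>prob (\<Union>n. ?I n) = 1\<close> assms(4) by (intro order_tendstoD(1)) auto
  then show ?thesis using eventually_happens'[OF sequentially_bot] by blast
qed

end

section \<open>Events of probability close to one\<close>

context prob_space
begin

text \<open>Phrased with a covering event because \<open>P\<close> may involve suprema over order intervals and need
  not be measurable.\<close>

definition likely :: "real \<Rightarrow> ('a \<Rightarrow> bool) \<Rightarrow> bool" where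
  "likely e P \<longleftrightarrow> (\<exists>A\<in>events. prob A \<le> e \<and> (\<forall>\<omega>\<in>space M - A. P \<omega>))"

lemma likely_mono:
  assumes "likely e P" "e \<le> e'" "\<And>\<omega>. \<omega> \<in> space M \<Longrightarrow> P \<omega> \<Longrightarrow> Q \<omega>"
  shows "likely e' Q"
  using assms unfolding likely_def by (meson DiffD1 order_trans)

lemma likely_conj:
  assumes "likely e P" "likely e' Q"
  shows "likely (e + e') (\<lambda>\<omega>. P \<omega> \<and> Q \<omega>)"
proof -
  obtain A B where "A \<in> events" "prob A \<le> e" "\<forall>\<omega>\<in>space M - A. P \<omega>"
    and "B \<in> events" "prob B \<le> e'" "\<forall>\<omega>\<in>space M - B. Q \<omega>"
    using assms unfolding likely_def by blast
  moreover from this have "prob (A \<union> B) \<le> e + e'"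
    using measure_Un_le[of A M B] by simp
  ultimately show ?thesis unfolding likely_def by (intro bexI[of _ "A \<union> B"]) auto
qed

lemma likely_conj':
  assumes "likely (e / 2) P" "likely (e / 2) Q" "\<And>\<omega>. \<omega> \<in> space M \<Longrightarrow> P \<omega> \<Longrightarrow> Q \<omega> \<Longrightarrow> R \<omega>"
  shows "likely e R"
  using likely_conj[OF assms(1,2)] by (rule likely_mono) (use assms(3) in auto)

lemma likely_finite_ball:
  assumes "\<And>k. k < (n::nat) \<Longrightarrow> likely e (P k)"
  shows "likely (real n * e) (\<lambda>\<omega>. \<forall>k<n. P k \<omega>)"
  using assms
proof (induction n)
  case 0
  then show ?case unfolding likely_def by (intro bexI[of _ "{}"]) auto
next
  case (Suc n)
  have "likely (real n * e + e) (\<lambda>\<omega>. (\<forall>k<n. P k \<omega>) \<and> P n \<omega>)"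
    by (intro likely_conj Suc) auto
  then show ?case by (rule likely_mono) (auto simp: algebra_simps less_Suc_eq)
qed

lemma likely_sums:
  assumes "\<And>n. likely (e n) (P n)" "e sums s"
  shows "likely s (\<lambda>\<omega>. \<forall>n. P n \<omega>)"
proof -
  obtain A where A: "\<And>n. A n \<in> events" "\<And>n. prob (A n) \<le> e n" "\<And>n. \<forall>\<omega>\<in>space M - A n. P n \<omega>"
    using assms(1) unfolding likely_def by metis
  have summable: "summable (\<lambda>n. prob (A n))"
    by (rule summable_comparison_test'[OF sums_summable[OF assms(2)], where N = 0]) (use A(2) in simp)
  have "prob (\<Union>n. A n) \<le> (\<Sum>n. prob (A n))"
    using A(1) summable by (intro finite_measure_subadditive_countably) auto
  also have "\<dots> \<le> suminf e"
    by (rule suminf_le[OF A(2) summable sums_summable[OF assms(2)]])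
  also have "\<dots> = s" using assms(2) by (rule sums_unique[symmetric])
  finally show ?thesis
    unfolding likely_def using A by (intro bexI[of _ "\<Union>n. A n"]) auto
qed

text \<open>The exceptional event is the lower limit of the events \<open>A n\<close>. It is an
  increasing union of the sets \<open>B m\<close>, each of probability at most \<open>e\<close>, so
  infinitely many conditions cost no more than one.\<close>

lemma likely_frequently:
  assumes "\<And>n::nat. likely e (P n)"
  shows "likely e (\<lambda>\<omega>. \<exists>\<^sub>F n in sequentially. P n \<omega>)"
proof -
  obtain A where A: "\<And>n. A n \<in> events" "\<And>n. prob (A n) \<le> e" "\<And>n. \<forall>\<omega>\<in>space M - A n. P n \<omega>"
    using assms unfolding likely_def by metis
  define B where "B m = (\<Inter>n\<in>{m..}. A n)" for m
  have B: "B m \<in> events" for m unfolding B_def using A(1) by (intro sets.countable_INT') auto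
  have "incseq B" unfolding B_def by (intro monoI INF_superset_mono) auto
  then have "(\<lambda>m. prob (B m)) \<longlonglongrightarrow> prob (\<Union>m. B m)"
    using B by (intro finite_Lim_measure_incseq) auto
  moreover have "prob (B m) \<le> e" for m
  proof -
    have "prob (B m) \<le> prob (A m)" unfolding B_def using A(1) by (intro finite_measure_mono) auto
    then show ?thesis using A(2)[of m] by linarith
  qed
  ultimately have "prob (\<Union>m. B m) \<le> e" by (intro LIMSEQ_le_const2) auto
  moreover have "\<exists>\<^sub>F n in sequentially. P n \<omega>" if "\<omega> \<in> space M - (\<Union>m. B m)" for \<omega>
    unfolding frequently_sequentially
  proof
    fix m
    have "\<omega> \<notin> B m" using that by auto
    then obtain n where "n \<ge> m" "\<omega> \<notin> A n" by (auto simp: B_def)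
    then show "\<exists>n\<ge>m. P n \<omega>" using A(3) that by blast
  qed
  ultimately show ?thesis unfolding likely_def using B by (intro bexI[of _ "\<Union>m. B m"]) auto
qed

lemma likely_iff:
  assumes "Measurable.pred M P"
  shows "likely e P \<longleftrightarrow> 1 - e \<le> prob {\<omega>\<in>space M. P \<omega>}"
proof -
  have ev: "{\<omega>\<in>space M. P \<omega>} \<in> events" using assms by (rule predE)
  have compl: "prob {\<omega>\<in>space M. \<not> P \<omega>} = 1 - prob {\<omega>\<in>space M. P \<omega>}"
    by (rule prob_neg) (rule ev)
  show ?thesis
  proof
    assume "likely e P"
    then obtain A where A: "A \<in> events" "prob A \<le> e" "\<forall>\<omega>\<in>space M - A. P \<omega>"
      unfolding likely_def by blast
    have "prob {\<omega>\<in>space M. \<not> P \<omega>} \<le> prob A" using A by (intro finite_measure_mono) auto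
    then show "1 - e \<le> prob {\<omega>\<in>space M. P \<omega>}" using A(2) compl by simp
  next
    assume "1 - e \<le> prob {\<omega>\<in>space M. P \<omega>}"
    then show "likely e P" unfolding likely_def using ev compl
      by (intro bexI[of _ "{\<omega>\<in>space M. \<not> P \<omega>}"]) (auto intro: sets.sets_Collect_neg)
  qed
qed

section \<open>Almost sure statements and convergence in probability\<close>

lemma AE_if_likely:
  assumes "\<And>e. e > 0 \<Longrightarrow> likely e P" shows "AE \<omega> in M. P \<omega>"
proof -
  have "\<forall>n. \<exists>A\<in>events. prob A \<le> inverse (real (Suc n)) \<and> (\<forall>\<omega>\<in>space M - A. P \<omega>)"
    using assms unfolding likely_def by simp
  then obtain A where A: "\<And>n. A n \<in> events" "\<And>n. prob (A n) \<le> inverse (real (Suc n))"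
    "\<And>n. \<forall>\<omega>\<in>space M - A n. P \<omega>" by metis
  have "prob (\<Inter>n. A n) \<le> inverse (real (Suc n))" for n
  proof -
    have "prob (\<Inter>n. A n) \<le> prob (A n)" using A(1) by (intro finite_measure_mono) auto
    then show ?thesis using A(2)[of n] by linarith
  qed
  then have "prob (\<Inter>n. A n) \<le> 0"
    by (intro LIMSEQ_le_const[OF LIMSEQ_inverse_real_of_nat]) auto
  then have "emeasure M (\<Inter>n. A n) = 0" by (simp add: emeasure_eq_measure measure_le_0_iff)
  then show ?thesis using A by (intro AE_I[where N = "\<Inter>n. A n"]) auto
qed

lemma AE_eq_if_likely:
  fixes X Y :: "'a \<Rightarrow> 'b::metric_space"
  assumes "\<And>d e. d > 0 \<Longrightarrow> e > 0 \<Longrightarrow> likely e (\<lambda>\<omega>. dist (X \<omega>) (Y \<omega>) \<le> d)"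
  shows "AE \<omega> in M. X \<omega> = Y \<omega>"
proof -
  have "AE \<omega> in M. \<forall>n. dist (X \<omega>) (Y \<omega>) \<le> inverse (real (Suc n))"
    unfolding AE_all_countable using assms by (intro allI AE_if_likely) auto
  then show ?thesis
  proof eventually_elim
    case (elim \<omega>)
    then have "dist (X \<omega>) (Y \<omega>) \<le> 0"
      by (intro LIMSEQ_le_const[OF LIMSEQ_inverse_real_of_nat]) auto
    then show ?case by simp
  qed
qed

text \<open>A measurable hull attaining the outer measure serves as the exceptional event in
  \<open>likely\<close>.\<close>

lemma tendsto_0_in_prob_iff:
  "tendsto_0_in_prob M X \<longleftrightarrow>
     (\<forall>d>0. \<forall>e>0. \<forall>\<^sub>F t in at_top. likely e (\<lambda>\<omega>. X t \<omega> \<le> ennreal d))"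
proof -
  have small: "outer_measure_of M {\<omega>\<in>space M. X t \<omega> > ennreal d} \<le> ennreal e \<longleftrightarrow>
      likely e (\<lambda>\<omega>. X t \<omega> \<le> ennreal d)" if "e > 0" for t d e
  proof
    have sub: "{\<omega>\<in>space M. X t \<omega> > ennreal d} \<subseteq> space M" by auto
    assume *: "outer_measure_of M {\<omega>\<in>space M. X t \<omega> > ennreal d} \<le> ennreal e"
    obtain A where "A \<in> events" "{\<omega>\<in>space M. X t \<omega> > ennreal d} \<subseteq> A"
      "outer_measure_of M {\<omega>\<in>space M. X t \<omega> > ennreal d} = emeasure M A"
      using outer_measure_of_attain[OF sub] by blast
    moreover from this have "prob A \<le> e"
      using * that by (simp add: emeasure_eq_measure)
    ultimately show "likely e (\<lambda>\<omega>. X t \<omega> \<le> ennreal d)"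
      unfolding likely_def by (intro bexI[of _ A]) (auto intro: leI)
  next
    assume "likely e (\<lambda>\<omega>. X t \<omega> \<le> ennreal d)"
    then obtain A where A: "A \<in> events" "prob A \<le> e" "\<forall>\<omega>\<in>space M - A. X t \<omega> \<le> ennreal d"
      unfolding likely_def by blast
    have "outer_measure_of M {\<omega>\<in>space M. X t \<omega> > ennreal d} \<le> outer_measure_of M A"
      using A(3) by (intro outer_measure_of_mono) (auto dest: leD)
    then show "outer_measure_of M {\<omega>\<in>space M. X t \<omega> > ennreal d} \<le> ennreal e"
      using A(1,2) by (auto simp: emeasure_eq_measure ennreal_leI intro: order_trans)
  qed
  have "(f \<longlongrightarrow> 0) at_top \<longleftrightarrow> (\<forall>e>0. \<forall>\<^sub>F t in at_top. f t \<le> ennreal e)" for f :: "real \<Rightarrow> ennreal"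
  proof
    assume "(f \<longlongrightarrow> 0) at_top"
    then have "\<forall>\<^sub>F t in at_top. f t < ennreal e" if "e > 0" for e
      using that by (intro order_tendstoD(2)) auto
    then show "\<forall>e>0. \<forall>\<^sub>F t in at_top. f t \<le> ennreal e"
      by (meson eventually_mono less_imp_le)
  next
    assume f: "\<forall>e>0. \<forall>\<^sub>F t in at_top. f t \<le> ennreal e"
    show "(f \<longlongrightarrow> 0) at_top"
    proof (rule order_tendstoI)
      fix a :: ennreal assume "0 < a"
      then obtain b where b: "0 < b" "b < a" using dense by blast
      then obtain e where "b = ennreal e" by (cases b) auto
      then have "0 < e" "ennreal e < a" using b by auto
      then show "\<forall>\<^sub>F t in at_top. f t < a" using f by (auto elim!: eventually_mono)
    qed auto
  qed
  then show ?thesis unfolding tendsto_0_in_prob_def using small by simp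
qed

text \<open>Along times \<open>T n\<close> with tolerance and failure probability both equal to the
  geometric term \<open>h n\<close>, the increments are summable outside an event of small
  probability. The limit along this sequence is then compared with all late times.\<close>

lemma Cauchy_in_prob_limit:
  fixes X :: "real \<Rightarrow> 'a \<Rightarrow> 'b::{banach, second_countable_topology}"
  assumes meas: "\<And>t. t \<ge> 0 \<Longrightarrow> X t \<in> borel_measurable M"
    and Cauchy: "\<And>d e. d > 0 \<Longrightarrow> e > 0 \<Longrightarrow>
      \<exists>T\<ge>0. \<forall>t\<ge>T. likely e (\<lambda>\<omega>. dist (X t \<omega>) (X T \<omega>) \<le> d)"
  obtains v where "v \<in> borel_measurable M"
    "\<And>d e. d > 0 \<Longrightarrow> e > 0 \<Longrightarrow> \<forall>\<^sub>F t in at_top. likely e (\<lambda>\<omega>. dist (X t \<omega>) (v \<omega>) \<le> d)"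
proof -
  define h :: "nat \<Rightarrow> real" where "h n = (1/2) ^ n" for n
  have h: "h n > 0" "h (Suc n) \<le> h n" for n by (auto simp: h_def)
  have "\<forall>n. \<exists>T\<ge>0. \<forall>t\<ge>T. likely (h n) (\<lambda>\<omega>. dist (X t \<omega>) (X T \<omega>) \<le> h n)"
    using Cauchy[OF h(1) h(1)] by simp
  from choice[OF this] obtain T
    where "\<forall>n. T n \<ge> 0 \<and> (\<forall>t\<ge>T n. likely (h n) (\<lambda>\<omega>. dist (X t \<omega>) (X (T n) \<omega>) \<le> h n))" ..
  then have T0: "T n \<ge> 0"
    and T: "t \<ge> T n \<Longrightarrow> likely (h n) (\<lambda>\<omega>. dist (X t \<omega>) (X (T n) \<omega>) \<le> h n)" for n t
    by simp_all
  define Y where "Y n \<omega> = X (T n) \<omega>" for n \<omega>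
  \<comment> \<open>The times \<open>T n\<close> need not increase, so the earlier of two neighbours
    acts as the reference time.\<close>
  have step: "likely (h n) (\<lambda>\<omega>. dist (Y n \<omega>) (Y (Suc n) \<omega>) \<le> h n)" for n
  proof (cases "T n \<le> T (Suc n)")
    case True
    then show ?thesis using T[of n "T (Suc n)"] by (simp add: Y_def dist_commute)
  next
    case False
    then have "likely (h (Suc n)) (\<lambda>\<omega>. dist (Y n \<omega>) (Y (Suc n) \<omega>) \<le> h (Suc n))"
      using T[of "Suc n" "T n"] by (simp add: Y_def)
    then show ?thesis by (rule likely_mono) (use h(2)[of n] in auto)
  qed
  \<comment> \<open>Where the sequence diverges, \<open>lim\<close> returns an unspecified value.
    The estimates on \<open>v\<close> are made only outside exceptional events on which this could
    happen.\<close>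
  define v where "v \<omega> = lim (\<lambda>n. Y n \<omega>)" for \<omega>
  have sums: "(\<lambda>n. h (m + n)) sums (2 * h m)" for m
    using sums_mult[OF geometric_sums[of "1/2::real"], of "h m"] by (simp add: h_def power_add mult.commute)
  have close: "likely (2 * h m) (\<lambda>\<omega>. dist (Y m \<omega>) (v \<omega>) \<le> 2 * h m)" for m
  proof (rule likely_mono[OF likely_sums[OF step sums]])
    fix \<omega> assume *: "\<forall>n. dist (Y (m + n) \<omega>) (Y (Suc (m + n)) \<omega>) \<le> h (m + n)"
    define D where "D n = Y (m + Suc n) \<omega> - Y (m + n) \<omega>" for n
    have D: "norm (D n) \<le> h (m + n)" for n
      using *[rule_format, of n] by (simp add: D_def dist_norm norm_minus_commute)
    have summ: "summable (\<lambda>n. norm (D n))"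
      by (rule summable_comparison_test'[OF sums_summable[OF sums], where N = 0]) (use D in simp)
    have "D sums suminf D" using summable_norm_cancel[OF summ] by (rule summable_sums)
    moreover have "(\<Sum>k<n. D k) = Y (n + m) \<omega> - Y m \<omega>" for n
      unfolding D_def using sum_lessThan_telescope[of "\<lambda>n. Y (m + n) \<omega>" n] by (simp add: add.commute)
    ultimately have "(\<lambda>n. Y (n + m) \<omega> - Y m \<omega>) \<longlonglongrightarrow> suminf D" by (simp add: sums_def)
    then have "(\<lambda>n. (Y (n + m) \<omega> - Y m \<omega>) + Y m \<omega>) \<longlonglongrightarrow> suminf D + Y m \<omega>"
      by (intro tendsto_intros)
    then have "(\<lambda>n. Y n \<omega>) \<longlonglongrightarrow> suminf D + Y m \<omega>"
      using LIMSEQ_offset[of "\<lambda>n. Y n \<omega>" m] by simp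
    then have "v \<omega> = suminf D + Y m \<omega>" unfolding v_def by (rule limI)
    moreover have "norm (suminf D) \<le> 2 * h m"
    proof -
      have "norm (suminf D) \<le> (\<Sum>n. norm (D n))" by (rule summable_norm[OF summ])
      also have "\<dots> \<le> (\<Sum>n. h (m + n))"
        by (rule suminf_le[OF D summ sums_summable[OF sums]])
      also have "\<dots> = 2 * h m" using sums by (rule sums_unique[symmetric])
      finally show ?thesis .
    qed
    ultimately show "dist (Y m \<omega>) (v \<omega>) \<le> 2 * h m" by (simp add: dist_norm)
  qed simp
  show thesis
  proof
    show "v \<in> borel_measurable M"
      unfolding v_def Y_def using meas T0 by (intro borel_measurable_lim_metric) auto
    fix d e :: real assume "d > 0" "e > 0"
    \<comment> \<open>The factor 3 pays for \<open>h m\<close> from \<open>X t\<close> to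
      \<open>Y m\<close> and \<open>2 * h m\<close> from \<open>Y m\<close> to \<open>v\<close>, in
      distance and in probability.\<close>
    obtain m where m: "h m < min d e / 3"
      using real_arch_pow_inv[of "min d e / 3" "1/2"] \<open>d > 0\<close> \<open>e > 0\<close> by (auto simp: h_def)
    show "\<forall>\<^sub>F t in at_top. likely e (\<lambda>\<omega>. dist (X t \<omega>) (v \<omega>) \<le> d)"
      using eventually_ge_at_top[of "T m"]
    proof eventually_elim
      case (elim t)
      show ?case
      proof (rule likely_mono[OF likely_conj[OF T[OF elim] close]])
        show "h m + 2 * h m \<le> e" using m by auto
        fix \<omega> assume "dist (X t \<omega>) (X (T m) \<omega>) \<le> h m \<and> dist (Y m \<omega>) (v \<omega>) \<le> 2 * h m"
        then show "dist (X t \<omega>) (v \<omega>) \<le> d"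
          using dist_triangle[of "X t \<omega>" "v \<omega>" "X (T m) \<omega>"] m by (simp add: Y_def)
      qed
    qed
  qed
qed

lemma likely_distr:
  assumes "likely e P" "f \<in> measurable M M" "distr M M f = M"
  shows "likely e (\<lambda>\<omega>. P (f \<omega>))"
proof -
  obtain A where A: "A \<in> events" "prob A \<le> e" "\<forall>\<omega>\<in>space M - A. P \<omega>"
    using assms(1) unfolding likely_def by blast
  have "prob (f -` A \<inter> space M) = prob A"
    using measure_distr[OF assms(2) A(1)] assms(3) by simp
  then show ?thesis unfolding likely_def
    using A assms(2) by (intro bexI[of _ "f -` A \<inter> space M"]) (auto dest: measurable_space)
qed

end

section \<open>Monotone mixing random dynamical systems\<close>

text \<open>The dynamical argument needs the space V only through the mass that \<open>\<mu>\<close>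
  gives to order intervals, so this is recorded as \<open>interval_tight\<close>.\<close>

locale monotone_mixing_rds = random_dynamical_system M \<theta> \<phi> + normal_ordered_space C
  for M :: "'w measure" and \<theta>
    and \<phi> :: "real \<Rightarrow> 'w \<Rightarrow> 'h::{banach, second_countable_topology} \<Rightarrow> 'h" and C :: "'h set" +
  fixes \<mu> :: "'h measure"
  assumes monotone: "order_preserving C M \<phi>" and mixing: "strongly_mixing M \<phi> \<mu>"
    and interval_tight: "e > 0 \<Longrightarrow> \<exists>a b. measure \<mu> (interval a b) > 1 - e"
begin

lemma prob_space_\<mu>: "prob_space \<mu>" and sets_\<mu>: "sets \<mu> = sets borel"
  using mixing unfolding strongly_mixing_def by auto

lemma measurable_\<theta> [measurable]: "\<theta> t \<in> measurable M M"
  using measurable_compose[OF measurable_Pair1' measurable_shift, of t] by simp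

lemma measurable_\<phi>:
  assumes "t \<ge> 0" and [measurable]: "f \<in> measurable M M" "X \<in> borel_measurable M"
  shows "(\<lambda>\<omega>. \<phi> t (f \<omega>) (X \<omega>)) \<in> borel_measurable M"
proof -
  have "(\<lambda>\<omega>. (t, f \<omega>, X \<omega>)) \<in> M \<rightarrow>\<^sub>M restrict_space borel {0..} \<Otimes>\<^sub>M (M \<Otimes>\<^sub>M borel)"
    using assms(1) by (intro measurable_Pair measurable_const assms) (auto simp: space_restrict_space)
  from measurable_compose[OF this measurable_cocycle] show ?thesis by simp
qed

lemma \<theta>_space: "\<omega> \<in> space M \<Longrightarrow> \<theta> t \<omega> \<in> space M"
  using measurable_space[OF measurable_\<theta>] .

lemma likely_shift: "likely e P \<Longrightarrow> likely e (\<lambda>\<omega>. P (\<theta> t \<omega>))"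
  using likely_distr[OF _ measurable_\<theta> shift_preserving] .

lemma \<theta>_minus: "\<omega> \<in> space M \<Longrightarrow> \<theta> (- t) (\<theta> t \<omega>) = \<omega>" "\<omega> \<in> space M \<Longrightarrow> \<theta> t (\<theta> (- t) \<omega>) = \<omega>"
  using shift_add[of \<omega> "- t" t] shift_add[of \<omega> t "- t"] shift_0 by auto

lemma \<phi>_interval:
  assumes "t \<ge> 0" "\<omega> \<in> space M" "z \<in> interval a b"
  shows "\<phi> t \<omega> z \<in> interval (\<phi> t \<omega> a) (\<phi> t \<omega> b)"
  using assms monotone unfolding order_preserving_def interval_iff by blast

section \<open>Convergence of laws and synchronisation of trajectories\<close>

lemma tendsto_law:
  assumes A: "A \<in> sets borel"
  shows "((\<lambda>t. prob {\<omega>\<in>space M. \<phi> t \<omega> x \<in> A}) \<longlongrightarrow> measure \<mu> A) at_top"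
proof -
  interpret \<mu>: prob_space \<mu> by (rule prob_space_\<mu>)
  have bound: "\<bar>prob {\<omega>\<in>space M. \<phi> t \<omega> x \<in> A} - measure \<mu> A\<bar>
      \<le> total_variation_dist (distr M borel (\<lambda>\<omega>. \<phi> t \<omega> x)) \<mu>" if "t \<ge> 0" for t
  proof -
    have meas: "(\<lambda>\<omega>. \<phi> t \<omega> x) \<in> borel_measurable M" using that by (intro measurable_\<phi>) auto
    interpret D: prob_space "distr M borel (\<lambda>\<omega>. \<phi> t \<omega> x)" by (rule prob_space_distr[OF meas])
    have "\<bar>measure (distr M borel (\<lambda>\<omega>. \<phi> t \<omega> x)) A - measure \<mu> A\<bar>
        \<le> total_variation_dist (distr M borel (\<lambda>\<omega>. \<phi> t \<omega> x)) \<mu>"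
      unfolding total_variation_dist_def
    proof (rule cSUP_upper)
      show "A \<in> sets (distr M borel (\<lambda>\<omega>. \<phi> t \<omega> x))" using A by simp
      have "\<bar>D.prob B - measure \<mu> B\<bar> \<le> 1" for B
        using D.prob_le_1[of B] \<mu>.prob_le_1[of B] measure_nonneg[of _ B] by (smt (verit))
      then show "bdd_above ((\<lambda>A. \<bar>D.prob A - measure \<mu> A\<bar>) ` sets (distr M borel (\<lambda>\<omega>. \<phi> t \<omega> x)))"
        by (intro bdd_aboveI[of _ 1]) auto
    qed
    also have "measure (distr M borel (\<lambda>\<omega>. \<phi> t \<omega> x)) A = prob {\<omega>\<in>space M. \<phi> t \<omega> x \<in> A}"
      using measure_distr[OF meas A] by (simp add: vimage_def Int_def conj_commute)
    finally show ?thesis .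
  qed
  have "((\<lambda>t. prob {\<omega>\<in>space M. \<phi> t \<omega> x \<in> A} - measure \<mu> A) \<longlongrightarrow> 0) at_top"
  proof (rule Lim_null_comparison)
    show "\<forall>\<^sub>F t in at_top. norm (prob {\<omega>\<in>space M. \<phi> t \<omega> x \<in> A} - measure \<mu> A)
        \<le> total_variation_dist (distr M borel (\<lambda>\<omega>. \<phi> t \<omega> x)) \<mu>"
      using eventually_ge_at_top[of 0] by eventually_elim (simp add: bound)
    show "((\<lambda>t. total_variation_dist (distr M borel (\<lambda>\<omega>. \<phi> t \<omega> x)) \<mu>) \<longlongrightarrow> 0) at_top"
      using mixing unfolding strongly_mixing_def by blast
  qed
  then show ?thesis by (rule LIM_zero_cancel)
qed

lemma likely_law:
  assumes "A \<in> sets borel" "measure \<mu> A > 1 - e"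
  shows "\<forall>\<^sub>F t in at_top. likely e (\<lambda>\<omega>. \<phi> t \<omega> x \<in> A)"
  using order_tendstoD(1)[OF tendsto_law[OF assms(1), of x] assms(2)] eventually_ge_at_top[of 0]
proof eventually_elim
  case (elim t)
  have "(\<lambda>\<omega>. \<phi> t \<omega> x) \<in> borel_measurable M" using elim by (intro measurable_\<phi>) auto
  then have "Measurable.pred M (\<lambda>\<omega>. \<phi> t \<omega> x \<in> A)"
    using assms(1) by (rule pred_sets2[rotated])
  then show ?case using elim by (subst likely_iff) auto
qed

text \<open>Finitely many balls around points \<open>w k\<close> carry most of \<open>\<mu>\<close>.
  When the lower trajectory is in ball \<open>k\<close> it lies in the down-set \<open>G k\<close>;
  equality of the limit laws forces the upper one into \<open>G k\<close> too, and
  \<open>below_dist_ge\<close> makes them close.\<close>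

lemma comparable_close:
  assumes "x \<preceq> y" "d > 0" "e > 0"
  shows "\<forall>\<^sub>F t in at_top. likely e (\<lambda>\<omega>. dist (\<phi> t \<omega> x) (\<phi> t \<omega> y) \<le> d)"
proof -
  interpret \<mu>: prob_space \<mu> by (rule prob_space_\<mu>)
  \<comment> \<open>Chosen so that \<open>nc * (r + r) = d\<close>.\<close>
  define r where "r = d / (2 * nc)"
  have r: "r > 0" using assms nc by (simp add: r_def)
  obtain D :: "'h set" where D: "countable D" "\<And>X. open X \<Longrightarrow> X \<noteq> {} \<Longrightarrow> \<exists>d\<in>D. d \<in> X"
    using countable_dense_setE by blast
  have "D \<noteq> {}" using D(2)[of UNIV] by auto
  define w where "w = from_nat_into D"
  have range_w: "range w = D" unfolding w_def using D(1) \<open>D \<noteq> {}\<close> by (rule range_from_nat_into[rotated])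
  define B where "B n = (\<Union>k<n. ball (w k) r)" for n
  have B_borel: "B n \<in> sets borel" for n unfolding B_def by (intro borel_open open_UN) auto
  have "(\<Union>n. B n) = UNIV"
  proof (intro equalityI subset_UNIV subsetI)
    fix z
    obtain p where "p \<in> D" "p \<in> ball z r" using D(2)[of "ball z r"] r by auto
    then obtain k where "w k \<in> ball z r" using range_w by auto
    then have "z \<in> B (Suc k)" unfolding B_def by (auto simp: dist_commute)
    then show "z \<in> (\<Union>n. B n)" by blast
  qed
  moreover have "incseq B" unfolding B_def by (intro monoI UN_mono) auto
  ultimately have "(\<lambda>n. \<mu>.prob (B n)) \<longlonglongrightarrow> \<mu>.prob UNIV"
    using \<mu>.finite_Lim_measure_incseq[of B] B_borel sets_\<mu> by auto
  moreover have "\<mu>.prob UNIV = 1"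
    using \<mu>.prob_space sets_eq_imp_space_eq[OF sets_\<mu>] by simp
  ultimately have "\<forall>\<^sub>F n in sequentially. \<mu>.prob (B n) > 1 - e / 2"
    using assms(3) by (intro order_tendstoD(1)) auto
  then obtain n where n: "\<mu>.prob (B n) > 1 - e / 2"
    using eventually_happens'[OF sequentially_bot] by blast
  \<comment> \<open>The share of each of the \<open>n\<close> test sets; \<open>Suc n\<close> keeps
    the denominator positive when \<open>n = 0\<close>.\<close>
  define e' where "e' = e / (2 * real (Suc n))"
  have e': "e' > 0" "real n * e' \<le> e / 2" using assms(3) by (auto simp: e'_def field_simps)
  define G where "G k = {z. below_dist (w k) z \<le> r}" for k
  have "closed (G k)" for k
    unfolding G_def by (intro closed_Collect_le continuous_below_dist continuous_intros)
  then have G: "G k \<in> sets borel" for k by (rule borel_closed)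
  have transfer: "\<forall>\<^sub>F t in at_top. likely e' (\<lambda>\<omega>. \<phi> t \<omega> x \<in> G k \<longrightarrow> \<phi> t \<omega> y \<in> G k)" for k
  proof -
    have "((\<lambda>t. prob {\<omega>\<in>space M. \<phi> t \<omega> x \<in> G k} - prob {\<omega>\<in>space M. \<phi> t \<omega> y \<in> G k})
 \<longlongrightarrow> measure \<mu> (G k) - measure \<mu> (G k)) at_top"
      by (intro tendsto_diff tendsto_law G)
    then have "\<forall>\<^sub>F t in at_top.
        prob {\<omega>\<in>space M. \<phi> t \<omega> x \<in> G k} - prob {\<omega>\<in>space M. \<phi> t \<omega> y \<in> G k} < e'"
      using e'(1) by (intro order_tendstoD(2)) auto
    then show ?thesis using eventually_ge_at_top[of 0]
    proof eventually_elim
      case (elim t)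
      have [measurable]: "(\<lambda>\<omega>. \<phi> t \<omega> x) \<in> borel_measurable M" "(\<lambda>\<omega>. \<phi> t \<omega> y) \<in> borel_measurable M"
        using elim by (auto intro!: measurable_\<phi>)
      note G[measurable]
      let ?X = "{\<omega>\<in>space M. \<phi> t \<omega> x \<in> G k}" and ?Y = "{\<omega>\<in>space M. \<phi> t \<omega> y \<in> G k}"
      \<comment> \<open>Because of this inclusion, the probability that only the lower trajectory is
        in \<open>G k\<close> is exactly the difference of the two laws on \<open>G k\<close>, which
        tends to 0.\<close>
      have "?Y \<subseteq> ?X"
      proof safe
        fix \<omega> assume "\<omega> \<in> space M" "\<phi> t \<omega> y \<in> G k"
        moreover from this have "\<phi> t \<omega> x \<preceq> \<phi> t \<omega> y"
          using monotone assms(1) elim unfolding order_preserving_def by blast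
        ultimately show "\<phi> t \<omega> x \<in> G k"
          using below_dist_mono[of "\<phi> t \<omega> x" "\<phi> t \<omega> y" "w k"] by (simp add: G_def)
      qed
      then have "prob (?X - ?Y) = prob ?X - prob ?Y" by (intro finite_measure_Diff) auto
      then show ?case
        unfolding likely_def using elim by (intro bexI[of _ "?X - ?Y"]) auto
    qed
  qed
  have "\<forall>\<^sub>F t in at_top. \<forall>k\<in>{..<n}. likely e' (\<lambda>\<omega>. \<phi> t \<omega> x \<in> G k \<longrightarrow> \<phi> t \<omega> y \<in> G k)"
    using transfer by (intro eventually_ball_finite) auto
  then show ?thesis
    using likely_law[OF B_borel n, of x] eventually_ge_at_top[of 0]
  proof eventually_elim
    case (elim t)
    have "likely (real n * e') (\<lambda>\<omega>. \<forall>k<n. \<phi> t \<omega> x \<in> G k \<longrightarrow> \<phi> t \<omega> y \<in> G k)"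
      using elim by (intro likely_finite_ball) auto
    from likely_conj[OF this elim(2)] show ?case
    proof (rule likely_mono)
      fix \<omega> assume \<omega>: "\<omega> \<in> space M"
        "(\<forall>k<n. \<phi> t \<omega> x \<in> G k \<longrightarrow> \<phi> t \<omega> y \<in> G k) \<and> \<phi> t \<omega> x \<in> B n"
      then obtain k where k: "k < n" "dist (\<phi> t \<omega> x) (w k) < r"
        by (auto simp: B_def dist_commute)
      then have "\<phi> t \<omega> x \<in> G k"
        using below_dist_le[of "w k" "\<phi> t \<omega> x"] by (simp add: G_def)
      then have "below_dist (w k) (\<phi> t \<omega> y) \<le> r" using \<omega> k by (simp add: G_def)
      moreover have "\<phi> t \<omega> x \<preceq> \<phi> t \<omega> y"
        using monotone assms(1) elim \<omega> unfolding order_preserving_def by blast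
      ultimately have "dist (\<phi> t \<omega> x) (\<phi> t \<omega> y) \<le> nc * (r + r)"
        using below_dist_ge[of "\<phi> t \<omega> x" "\<phi> t \<omega> y" "w k"] k nc
        by (smt (verit) mult_left_mono)
      then show "dist (\<phi> t \<omega> x) (\<phi> t \<omega> y) \<le> d" using nc by (simp add: r_def)
    qed (use e' in simp)
  qed
qed

lemma trajectories_close:
  assumes "d > 0" "e > 0"
  shows "\<forall>\<^sub>F t in at_top. likely e (\<lambda>\<omega>. dist (\<phi> t \<omega> x) (\<phi> t \<omega> y) \<le> d)"
proof -
  obtain z where z: "x \<preceq> z" "y \<preceq> z" using upper_bound by blast
  have "d / 2 > 0" "e / 2 > 0" using assms by auto
  from comparable_close[OF z(1) this] comparable_close[OF z(2) this] show ?thesis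
  proof eventually_elim
    case (elim t)
    from elim show ?case
    proof (rule likely_conj')
      fix \<omega> assume "dist (\<phi> t \<omega> x) (\<phi> t \<omega> z) \<le> d / 2" "dist (\<phi> t \<omega> y) (\<phi> t \<omega> z) \<le> d / 2"
      then show "dist (\<phi> t \<omega> x) (\<phi> t \<omega> y) \<le> d"
        using dist_triangle2[of "\<phi> t \<omega> x" "\<phi> t \<omega> y" "\<phi> t \<omega> z"] by simp
    qed
  qed
qed

section \<open>Pullback trajectories and their limit in probability\<close>

definition pullback :: "real \<Rightarrow> 'w \<Rightarrow> 'h \<Rightarrow> 'h" where
  "pullback t \<omega> x = \<phi> t (\<theta> (- t) \<omega>) x"

lemma pullback_shift: "\<omega> \<in> space M \<Longrightarrow> pullback t (\<theta> t \<omega>) x = \<phi> t \<omega> x"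
  by (simp add: pullback_def \<theta>_minus)

text \<open>The inner pullback is the value at time \<open>- t\<close> of the trajectory started at
  time \<open>- (t + s)\<close>.\<close>

lemma pullback_add:
  assumes "s \<ge> 0" "t \<ge> 0" "\<omega> \<in> space M"
  shows "pullback (t + s) \<omega> x = \<phi> t (\<theta> (- t) \<omega>) (pullback s (\<theta> (- t) \<omega>) x)"
proof -
  have "- s + - t = - (t + s)" by simp
  then have "\<theta> (- s) (\<theta> (- t) \<omega>) = \<theta> (- (t + s)) \<omega>" using shift_add[of \<omega> "- s" "- t"] assms by metis
  moreover have "\<theta> s (\<theta> (- s) (\<theta> (- t) \<omega>)) = \<theta> (- t) \<omega>" using assms by (simp add: \<theta>_minus \<theta>_space)
  ultimately show ?thesis
    using cocycle_add[of t s "\<theta> (- (t + s)) \<omega>"] assms by (simp add: pullback_def \<theta>_space)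
qed

lemma \<phi>_pullback:
  assumes "s \<ge> 0" "t \<ge> 0" "\<omega> \<in> space M"
  shows "\<phi> s \<omega> (pullback t \<omega> x) = pullback (s + t) (\<theta> s \<omega>) x"
  using pullback_add[of t s "\<theta> s \<omega>" x] assms by (simp add: \<theta>_minus \<theta>_space)

lemma measurable_pullback: "t \<ge> 0 \<Longrightarrow> (\<lambda>\<omega>. pullback t \<omega> x) \<in> borel_measurable M"
  unfolding pullback_def by (intro measurable_\<phi>) auto

text \<open>After time \<open>S\<close> the law of the trajectory gives most of its mass to one
  interval. Shifting this to time \<open>- t\<close> and applying the monotone map up to time 0
  gives the claim, with \<open>a\<close>, \<open>b\<close> and \<open>S\<close> independent of
  \<open>t\<close>.\<close>

lemma absorbing_interval:
  assumes "e > 0"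
  shows "\<exists>a b. \<exists>S\<ge>0. \<forall>s\<ge>S. \<forall>t\<ge>0.
      likely e (\<lambda>\<omega>. pullback (t + s) \<omega> x \<in> interval (pullback t \<omega> a) (pullback t \<omega> b))"
proof -
  obtain a b where "measure \<mu> (interval a b) > 1 - e" using interval_tight[OF assms] by blast
  from likely_law[OF borel_closed[OF closed_interval] this]
  obtain S where S: "\<And>s. s \<ge> S \<Longrightarrow> likely e (\<lambda>\<omega>. \<phi> s \<omega> x \<in> interval a b)"
    by (auto simp: eventually_at_top_linorder)
  show ?thesis
  proof (rule exI[of _ a], rule exI[of _ b], rule exI[of _ "max 0 S"], intro conjI allI impI)
    fix s t :: real assume st: "s \<ge> max 0 S" "t \<ge> 0"
    then have "likely e (\<lambda>\<omega>. \<phi> s \<omega> x \<in> interval a b)" by (intro S) auto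
    then have "likely e (\<lambda>\<omega>. \<phi> s (\<theta> (- s) (\<theta> (- t) \<omega>)) x \<in> interval a b)"
      by (intro likely_shift)
    then show "likely e (\<lambda>\<omega>. pullback (t + s) \<omega> x \<in> interval (pullback t \<omega> a) (pullback t \<omega> b))"
    proof (rule likely_mono)
      fix \<omega> assume \<omega>: "\<omega> \<in> space M" "\<phi> s (\<theta> (- s) (\<theta> (- t) \<omega>)) x \<in> interval a b"
      have "pullback (t + s) \<omega> x = \<phi> t (\<theta> (- t) \<omega>) (\<phi> s (\<theta> (- s) (\<theta> (- t) \<omega>)) x)"
        using pullback_add[of s t \<omega> x] st \<omega> by (simp add: pullback_def)
      then show "pullback (t + s) \<omega> x \<in> interval (pullback t \<omega> a) (pullback t \<omega> b)"
        using \<phi>_interval[of t "\<theta> (- t) \<omega>"] \<omega> st by (simp add: pullback_def \<theta>_space)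
    qed simp
  qed simp
qed

lemma pullbacks_close:
  assumes "d > 0" "e > 0"
  shows "\<forall>\<^sub>F t in at_top. likely e (\<lambda>\<omega>. dist (pullback t \<omega> x) (pullback t \<omega> y) \<le> d)"
  using trajectories_close[OF assms] unfolding pullback_def
  by (rule eventually_mono) (rule likely_shift)

text \<open>At a fixed \<open>T\<close> the pullbacks of \<open>a\<close>, \<open>b\<close> and
  \<open>x\<close> are close, and every pullback started before \<open>- (T + S)\<close> is trapped
  between those of \<open>a\<close> and \<open>b\<close> at \<open>T\<close>. The trap works only
  from \<open>T + S\<close> on, so \<open>T + S\<close> is the reference time returned.\<close>

lemma pullback_Cauchy:
  assumes "d > 0" "e > 0"
  shows "\<exists>T\<ge>0. \<forall>t\<ge>T. likely e (\<lambda>\<omega>. dist (pullback t \<omega> x) (pullback T \<omega> x) \<le> d)"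
proof -
  \<comment> \<open>Chosen so that \<open>nc * d' + d' = d / 2\<close>: the width of the trap plus
    the distance from \<open>a\<close> to \<open>x\<close> at time \<open>T\<close>.\<close>
  define d' where "d' = d / (2 * (nc + 1))"
  have d': "d' > 0" "2 * (nc + 1) * d' = d" using assms nc by (simp_all add: d'_def)
  have e4: "e / 4 > 0" and e8: "e / 8 > 0" using assms by auto
  obtain a b S where S: "S \<ge> 0" "\<forall>s\<ge>S. \<forall>t\<ge>0.
      likely (e / 4) (\<lambda>\<omega>. pullback (t + s) \<omega> x \<in> interval (pullback t \<omega> a) (pullback t \<omega> b))"
    using absorbing_interval[OF e4, of x] by blast
  have "\<forall>\<^sub>F t in at_top. t \<ge> 0 \<and> likely (e / 8) (\<lambda>\<omega>. dist (pullback t \<omega> a) (pullback t \<omega> b) \<le> d') \<and>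
      likely (e / 8) (\<lambda>\<omega>. dist (pullback t \<omega> a) (pullback t \<omega> x) \<le> d')"
    by (intro eventually_conj pullbacks_close d'(1) e8 eventually_ge_at_top)
  then obtain T where T: "T \<ge> 0" "likely (e / 8) (\<lambda>\<omega>. dist (pullback T \<omega> a) (pullback T \<omega> b) \<le> d')"
    "likely (e / 8) (\<lambda>\<omega>. dist (pullback T \<omega> a) (pullback T \<omega> x) \<le> d')"
    using eventually_happens'[OF trivial_limit_at_top_linorder] by blast
  have near: "likely (e / 2) (\<lambda>\<omega>. dist (pullback t \<omega> x) (pullback T \<omega> x) \<le> d / 2)"
    if "t \<ge> T + S" for t
  proof -
    have "likely (e / 4) (\<lambda>\<omega>. pullback t \<omega> x \<in> interval (pullback T \<omega> a) (pullback T \<omega> b))"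
      using S(2)[rule_format, of "t - T" T] that T(1) by simp
    from likely_conj[OF this likely_conj[OF T(2,3)]] show ?thesis
    proof (rule likely_mono)
      fix \<omega> assume *: "pullback t \<omega> x \<in> interval (pullback T \<omega> a) (pullback T \<omega> b) \<and>
        dist (pullback T \<omega> a) (pullback T \<omega> b) \<le> d' \<and> dist (pullback T \<omega> a) (pullback T \<omega> x) \<le> d'"
      have "dist (pullback t \<omega> x) (pullback T \<omega> a) \<le> nc * dist (pullback T \<omega> a) (pullback T \<omega> b)"
        using * by (intro dist_interval_le) auto
      also have "\<dots> \<le> nc * d'" using * nc by (intro mult_left_mono) auto
      finally have "dist (pullback t \<omega> x) (pullback T \<omega> x) \<le> nc * d' + d'"
        using dist_triangle[of "pullback t \<omega> x" "pullback T \<omega> x" "pullback T \<omega> a"] * by linarith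
      also have "nc * d' + d' = d / 2" using d'(2) by (simp add: algebra_simps)
      finally show "dist (pullback t \<omega> x) (pullback T \<omega> x) \<le> d / 2" .
    qed simp
  qed
  have "likely e (\<lambda>\<omega>. dist (pullback t \<omega> x) (pullback (T + S) \<omega> x) \<le> d)" if "t \<ge> T + S" for t
    using near[OF that] near[OF order_refl]
  proof (rule likely_conj')
    fix \<omega> assume "dist (pullback t \<omega> x) (pullback T \<omega> x) \<le> d / 2"
      "dist (pullback (T + S) \<omega> x) (pullback T \<omega> x) \<le> d / 2"
    then show "dist (pullback t \<omega> x) (pullback (T + S) \<omega> x) \<le> d"
      using dist_triangle2[of "pullback t \<omega> x" "pullback (T + S) \<omega> x" "pullback T \<omega> x"] by simp
  qed
  then show ?thesis using T(1) S(1) by (intro exI[of _ "T + S"]) auto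
qed

text \<open>The limit is built for the starting point 0; the mutual closeness of pullbacks carries
  it over to every other \<open>x\<close>.\<close>

lemma pullback_limit:
  obtains v where "v \<in> borel_measurable M"
    "\<And>x d e. d > 0 \<Longrightarrow> e > 0 \<Longrightarrow> \<forall>\<^sub>F t in at_top. likely e (\<lambda>\<omega>. dist (pullback t \<omega> x) (v \<omega>) \<le> d)"
proof -
  obtain v where v: "v \<in> borel_measurable M"
    "\<And>d e. d > 0 \<Longrightarrow> e > 0 \<Longrightarrow> \<forall>\<^sub>F t in at_top. likely e (\<lambda>\<omega>. dist (pullback t \<omega> 0) (v \<omega>) \<le> d)"
    using Cauchy_in_prob_limit[of "\<lambda>t \<omega>. pullback t \<omega> 0"] measurable_pullback pullback_Cauchy by blast
  show thesis
  proof (rule that[OF v(1)])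
    fix x and d e :: real assume "d > 0" "e > 0"
    then have "d / 2 > 0" "e / 2 > 0" by auto
    from v(2)[OF this] pullbacks_close[OF this, of 0 x]
    show "\<forall>\<^sub>F t in at_top. likely e (\<lambda>\<omega>. dist (pullback t \<omega> x) (v \<omega>) \<le> d)"
    proof eventually_elim
      case (elim t)
      from elim show ?case
      proof (rule likely_conj')
        fix \<omega> assume "dist (pullback t \<omega> 0) (v \<omega>) \<le> d / 2"
          "dist (pullback t \<omega> 0) (pullback t \<omega> x) \<le> d / 2"
        then show "dist (pullback t \<omega> x) (v \<omega>) \<le> d"
          using dist_triangle3[of "pullback t \<omega> x" "v \<omega>" "pullback t \<omega> 0"] by simp
      qed
    qed
  qed
qed

section \<open>The limit point: invariance, support, attraction and minimality\<close>

context
  fixes v :: "'w \<Rightarrow> 'h"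
  assumes v_measurable: "v \<in> borel_measurable M"
    and v_limit: "\<And>x d e. d > 0 \<Longrightarrow> e > 0 \<Longrightarrow>
      \<forall>\<^sub>F t in at_top. likely e (\<lambda>\<omega>. dist (pullback t \<omega> x) (v \<omega>) \<le> d)"
begin

lemma forward_limit:
  assumes "d > 0" "e > 0"
  shows "\<forall>\<^sub>F t in at_top. likely e (\<lambda>\<omega>. dist (\<phi> t \<omega> x) (v (\<theta> t \<omega>)) \<le> d)"
  using v_limit[OF assms, of x]
proof eventually_elim
  case (elim t)
  from likely_shift[OF this, of t] show ?case
    by (rule likely_mono) (auto simp: pullback_shift)
qed

text \<open>Outside a small event, infinitely many members of a suitable sequence of pullbacks lie
  in \<open>F \<omega>\<close> and come arbitrarily close to \<open>v \<omega>\<close>, so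
  closedness suffices. The gap \<open>e' - e\<close> pays for the closeness.\<close>

lemma limit_in_closed:
  assumes e: "e < e'" and closed: "\<And>\<omega>. \<omega> \<in> space M \<Longrightarrow> closed (F \<omega>)"
    and F: "\<forall>\<^sub>F t in at_top. likely e (\<lambda>\<omega>. pullback t \<omega> x \<in> F \<omega>)"
  shows "likely e' (\<lambda>\<omega>. v \<omega> \<in> F \<omega>)"
proof -
  have "\<exists>t. likely e' (\<lambda>\<omega>. pullback t \<omega> x \<in> F \<omega> \<and> dist (pullback t \<omega> x) (v \<omega>) \<le> inverse (real (Suc n)))"
    for n
  proof -
    have "\<forall>\<^sub>F t in at_top. likely (e + (e' - e))
        (\<lambda>\<omega>. pullback t \<omega> x \<in> F \<omega> \<and> dist (pullback t \<omega> x) (v \<omega>) \<le> inverse (real (Suc n)))"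
    proof (rule eventually_elim2[OF F])
      show "\<forall>\<^sub>F t in at_top. likely (e' - e) (\<lambda>\<omega>. dist (pullback t \<omega> x) (v \<omega>) \<le> inverse (real (Suc n)))"
        using e by (intro v_limit) auto
    qed (rule likely_conj)
    from eventually_happens'[OF trivial_limit_at_top_linorder this] show ?thesis by simp
  qed
  then obtain t where t: "\<And>n. likely e' (\<lambda>\<omega>. pullback (t n) \<omega> x \<in> F \<omega> \<and>
      dist (pullback (t n) \<omega> x) (v \<omega>) \<le> inverse (real (Suc n)))" by metis
  from likely_frequently[OF t] show ?thesis
  proof (rule likely_mono)
    fix \<omega> assume \<omega>: "\<omega> \<in> space M" and freq: "\<exists>\<^sub>F n in sequentially.
      pullback (t n) \<omega> x \<in> F \<omega> \<and> dist (pullback (t n) \<omega> x) (v \<omega>) \<le> inverse (real (Suc n))"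
    have "v \<omega> \<in> closure (F \<omega>)"
      unfolding closure_approachable
    proof (intro allI impI)
      fix r :: real assume "r > 0"
      have "\<forall>\<^sub>F n in sequentially. inverse (real (Suc n)) < r"
        using order_tendstoD(2)[OF LIMSEQ_inverse_real_of_nat \<open>r > 0\<close>] .
      from frequently_eventually_frequently[OF freq this]
      obtain n where "pullback (t n) \<omega> x \<in> F \<omega>" "dist (pullback (t n) \<omega> x) (v \<omega>) < r"
        by (auto dest!: frequently_ex)
      then show "\<exists>y\<in>F \<omega>. dist y (v \<omega>) < r" by blast
    qed
    then show "v \<omega> \<in> F \<omega>" using closed[OF \<omega>] by (simp add: closure_closed)
  qed simp
qed

text \<open>Late pullbacks of 0 are trapped in a closed random interval, which then contains their
  limit. The same \<open>a\<close> and \<open>b\<close> serve all \<open>t\<close>, which allows the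
  time shift in the proof of invariance.\<close>

lemma limit_in_pullback_interval:
  assumes "e > 0"
  obtains a b where "\<And>t. t \<ge> 0 \<Longrightarrow> likely e (\<lambda>\<omega>. v \<omega> \<in> interval (pullback t \<omega> a) (pullback t \<omega> b))"
proof -
  have e: "e / 2 > 0" using assms by simp
  obtain a b S where "S \<ge> 0" and S: "\<forall>s\<ge>S. \<forall>t\<ge>0.
      likely (e / 2) (\<lambda>\<omega>. pullback (t + s) \<omega> 0 \<in> interval (pullback t \<omega> a) (pullback t \<omega> b))"
    using absorbing_interval[OF e, of 0] by blast
  show thesis
  proof (rule that)
    fix t :: real assume t: "t \<ge> 0"
    have "\<forall>\<^sub>F u in at_top.
        likely (e / 2) (\<lambda>\<omega>. pullback u \<omega> 0 \<in> interval (pullback t \<omega> a) (pullback t \<omega> b))"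
      using eventually_ge_at_top[of "t + S"]
    proof eventually_elim
      case (elim u)
      then show ?case using S[rule_format, of "u - t" t] t by simp
    qed
    from limit_in_closed[OF _ closed_interval this]
    show "likely e (\<lambda>\<omega>. v \<omega> \<in> interval (pullback t \<omega> a) (pullback t \<omega> b))"
      using assms by simp
  qed
qed

text \<open>Since \<^term>\<open>\<phi> s \<omega>\<close> need not be continuous, invariance cannot be obtained by passing to the
  limit in the cocycle property; instead \<^term>\<open>\<phi> s \<omega> (v \<omega>)\<close> is squeezed between two pullback
  trajectories.\<close>

lemma limit_invariant:
  assumes s: "s \<ge> 0"
  shows "AE \<omega> in M. \<phi> s \<omega> (v \<omega>) = v (\<theta> s \<omega>)"
proof (rule AE_eq_if_likely)
  fix d e :: real assume "d > 0" "e > 0"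
  \<comment> \<open>Chosen so that \<open>nc * (2 * d') + d' = d\<close>; both end points lie within
    \<open>d'\<close> of \<open>v (\<theta> s \<omega>)\<close>.\<close>
  define d' where "d' = d / (2 * nc + 1)"
  have d': "d' > 0" "(2 * nc + 1) * d' = d" using \<open>d > 0\<close> nc by (simp_all add: d'_def)
  have e: "e / 2 > 0" "e / 4 > 0" using \<open>e > 0\<close> by auto
  obtain a b where ab: "\<And>t. t \<ge> 0 \<Longrightarrow>
      likely (e / 2) (\<lambda>\<omega>. v \<omega> \<in> interval (pullback t \<omega> a) (pullback t \<omega> b))"
    using limit_in_pullback_interval[OF e(1)] by blast
  have "\<forall>\<^sub>F t in at_top. t \<ge> s \<and> likely (e / 4) (\<lambda>\<omega>. dist (pullback t \<omega> a) (v \<omega>) \<le> d') \<and>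
      likely (e / 4) (\<lambda>\<omega>. dist (pullback t \<omega> b) (v \<omega>) \<le> d')"
    by (intro eventually_conj v_limit d'(1) e eventually_ge_at_top)
  then obtain t where t: "t \<ge> s" "likely (e / 4) (\<lambda>\<omega>. dist (pullback t \<omega> a) (v \<omega>) \<le> d')"
    "likely (e / 4) (\<lambda>\<omega>. dist (pullback t \<omega> b) (v \<omega>) \<le> d')"
    using eventually_happens'[OF trivial_limit_at_top_linorder] by blast
  \<comment> \<open>Time \<open>t - s\<close> is used because \<open>\<phi> s \<omega>\<close>
    carries these end points to the pullbacks of age \<open>t\<close> over
    \<open>\<theta> s \<omega>\<close>, already known to be near
    \<open>v (\<theta> s \<omega>)\<close>.\<close>
  have "likely (e / 2) (\<lambda>\<omega>. v \<omega> \<in> interval (pullback (t - s) \<omega> a) (pullback (t - s) \<omega> b))"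
    using ab t(1) by simp
  from likely_conj[OF this likely_conj[OF likely_shift[OF t(2), of s] likely_shift[OF t(3), of s]]]
  show "likely e (\<lambda>\<omega>. dist (\<phi> s \<omega> (v \<omega>)) (v (\<theta> s \<omega>)) \<le> d)"
  proof (rule likely_mono)
    fix \<omega> assume \<omega>: "\<omega> \<in> space M"
      and *: "v \<omega> \<in> interval (pullback (t - s) \<omega> a) (pullback (t - s) \<omega> b) \<and>
        dist (pullback t (\<theta> s \<omega>) a) (v (\<theta> s \<omega>)) \<le> d' \<and> dist (pullback t (\<theta> s \<omega>) b) (v (\<theta> s \<omega>)) \<le> d'"
    let ?a = "pullback t (\<theta> s \<omega>) a" and ?b = "pullback t (\<theta> s \<omega>) b"
    have "\<phi> s \<omega> (v \<omega>) \<in> interval (\<phi> s \<omega> (pullback (t - s) \<omega> a)) (\<phi> s \<omega> (pullback (t - s) \<omega> b))"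
      using \<phi>_interval[OF s \<omega>] * by blast
    then have "\<phi> s \<omega> (v \<omega>) \<in> interval ?a ?b"
      using \<phi>_pullback[of s "t - s" \<omega>] s t(1) \<omega> by simp
    then have "dist (\<phi> s \<omega> (v \<omega>)) ?a \<le> nc * dist ?a ?b" by (rule dist_interval_le)
    also have "dist ?a ?b \<le> 2 * d'" using * dist_triangle2[of ?a ?b "v (\<theta> s \<omega>)"] by simp
    finally have "dist (\<phi> s \<omega> (v \<omega>)) (v (\<theta> s \<omega>)) \<le> nc * (2 * d') + d'"
      using * dist_triangle[of "\<phi> s \<omega> (v \<omega>)" "v (\<theta> s \<omega>)" ?a] nc by simp
    also have "\<dots> = d" using d'(2) by (simp add: algebra_simps)
    finally show "dist (\<phi> s \<omega> (v \<omega>)) (v (\<theta> s \<omega>)) \<le> d" .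
  qed simp
qed

text \<open>Inner regularity gives a compact \<open>K\<close> of almost full mass avoiding a Borel
  null set that contains the complement of \<open>R\<close>. Total variation convergence controls
  the laws on \<open>K\<close> itself, and \<open>K\<close> is closed, so the limit stays in
  it.\<close>

lemma limit_concentrated:
  assumes "AE x in \<mu>. x \<in> R" shows "AE \<omega> in M. v \<omega> \<in> R"
proof (rule AE_if_likely)
  fix e :: real assume "e > 0"
  interpret \<mu>: prob_space \<mu> by (rule prob_space_\<mu>)
  obtain N where N: "{x\<in>space \<mu>. x \<notin> R} \<subseteq> N" "emeasure \<mu> N = 0" "N \<in> sets \<mu>"
    using AE_E[OF assms] by blast
  have space: "space \<mu> = UNIV" using sets_eq_imp_space_eq[OF sets_\<mu>] by simp
  have "emeasure \<mu> (- N) = 1"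
    using \<mu>.emeasure_space_1 N(2,3) emeasure_compl[OF N(3)] space by (simp add: Compl_eq_Diff_UNIV)
  moreover have "emeasure \<mu> (- N) = (SUP K\<in>{K. K \<subseteq> - N \<and> compact K}. emeasure \<mu> K)"
    using N(3) sets_\<mu> space by (intro inner_regular) auto
  moreover have "ennreal (1 - e / 2) < 1" using \<open>e > 0\<close> ennreal_lessI[of 1 "1 - e / 2"] by simp
  ultimately have "ennreal (1 - e / 2) < (SUP K\<in>{K. K \<subseteq> - N \<and> compact K}. emeasure \<mu> K)" by simp
  then obtain K where K: "K \<subseteq> - N" "compact K" "ennreal (1 - e / 2) < emeasure \<mu> K"
    unfolding less_SUP_iff by blast
  then have "measure \<mu> K > 1 - e / 2" by (metis \<mu>.emeasure_eq_measure ennreal_leI not_le)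
  from likely_law[OF borel_closed[OF compact_imp_closed[OF K(2)]] this]
  have "\<forall>\<^sub>F t in at_top. likely (e / 2) (\<lambda>\<omega>. pullback t \<omega> 0 \<in> K)"
    unfolding pullback_def by (rule eventually_mono) (rule likely_shift)
  from limit_in_closed[OF _ compact_imp_closed[OF K(2)] this]
  have "likely e (\<lambda>\<omega>. v \<omega> \<in> K)" using \<open>e > 0\<close> by simp
  then show "likely e (\<lambda>\<omega>. v \<omega> \<in> R)"
    by (rule likely_mono) (use K N space in auto)
qed

lemma limit_invariant_compact: "invariant_compact_random_set M \<theta> \<phi> (\<lambda>\<omega>. {v \<omega>})"
proof -
  have "(\<lambda>\<omega>. semidist {x} {v \<omega>}) \<in> borel_measurable M" for x
    using v_measurable by (simp add: semidist_def)
  moreover have "AE \<omega> in M. \<phi> t \<omega> ` {v \<omega>} = {v (\<theta> t \<omega>)}" if "t \<ge> 0" for t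
    using limit_invariant[OF that] by simp
  ultimately show ?thesis
    unfolding invariant_compact_random_set_def random_closed_set_def by simp
qed

lemma limit_point_attractor: "weak_point_attractor M \<theta> \<phi> (\<lambda>\<omega>. {v \<omega>})"
  unfolding weak_point_attractor_def tendsto_0_in_prob_iff
proof (intro conjI allI impI limit_invariant_compact)
  fix x and d e :: real assume "d > 0" "e > 0"
  then show "\<forall>\<^sub>F t in at_top. likely e (\<lambda>\<omega>. semidist {\<phi> t \<omega> x} {v (\<theta> t \<omega>)} \<le> ennreal d)"
    using forward_limit[of d e x] by (simp add: semidist_def)
qed

text \<open>Monotonicity keeps the image of the interval between the two end trajectories, which
  approach each other and \<open>v\<close>; normality then bounds all its points uniformly.\<close>

lemma limit_interval_attractor: "weak_interval_attractor C M \<theta> \<phi> (\<lambda>\<omega>. {v \<omega>})"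
  unfolding weak_interval_attractor_def tendsto_0_in_prob_iff
proof (intro conjI allI impI limit_invariant_compact)
  fix x y and d e :: real assume xy: "x \<preceq> y" and "d > 0" "e > 0"
  define d' where "d' = d / (nc + 1)"
  have d': "d' > 0" "(nc + 1) * d' = d" using \<open>d > 0\<close> nc by (simp_all add: d'_def)
  have e: "e / 2 > 0" using \<open>e > 0\<close> by simp
  show "\<forall>\<^sub>F t in at_top.
      likely e (\<lambda>\<omega>. semidist (\<phi> t \<omega> ` interval x y) {v (\<theta> t \<omega>)} \<le> ennreal d)"
    using forward_limit[OF d'(1) e, of x] trajectories_close[OF d'(1) e, of x y] eventually_ge_at_top[of 0]
  proof eventually_elim
    case (elim t)
    from elim(1,2) show ?case
    proof (rule likely_conj')
      fix \<omega> assume \<omega>: "\<omega> \<in> space M" "dist (\<phi> t \<omega> x) (v (\<theta> t \<omega>)) \<le> d'" "dist (\<phi> t \<omega> x) (\<phi> t \<omega> y) \<le> d'"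
      have "dist (\<phi> t \<omega> z) (v (\<theta> t \<omega>)) \<le> d" if "z \<in> interval x y" for z
      proof -
        have "dist (\<phi> t \<omega> z) (\<phi> t \<omega> x) \<le> nc * dist (\<phi> t \<omega> x) (\<phi> t \<omega> y)"
          by (intro dist_interval_le \<phi>_interval that elim \<omega>)
        also have "\<dots> \<le> nc * d'" using \<omega> nc by (intro mult_left_mono) auto
        finally have "dist (\<phi> t \<omega> z) (v (\<theta> t \<omega>)) \<le> nc * d' + d'"
          using dist_triangle[of "\<phi> t \<omega> z" "v (\<theta> t \<omega>)" "\<phi> t \<omega> x"] \<omega> by linarith
        also have "\<dots> = d" using d'(2) by (simp add: algebra_simps)
        finally show ?thesis .
      qed
      then show "semidist (\<phi> t \<omega> ` interval x y) {v (\<theta> t \<omega>)} \<le> ennreal d"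
        by (auto simp: semidist_def intro!: SUP_least ennreal_leI)
    qed
  qed
qed

text \<open>Shifting the attraction of the starting point 0 by \<open>- t\<close> puts its pullback
  near \<open>B \<omega>\<close>, while the same pullback is near \<open>v \<omega>\<close>.
  Closedness of \<open>B \<omega>\<close> concludes.\<close>

lemma limit_in_point_attractor:
  assumes B: "weak_point_attractor M \<theta> \<phi> B"
  shows "AE \<omega> in M. v \<omega> \<in> B \<omega>"
proof -
  have "likely e (\<lambda>\<omega>. \<exists>b\<in>B \<omega>. dist (v \<omega>) b < d)" if "d > 0" "e > 0" for d e
  proof -
    have de: "d / 3 > 0" "e / 2 > 0" using that by auto
    have "\<forall>\<^sub>F t in at_top. likely (e / 2) (\<lambda>\<omega>. semidist {\<phi> t \<omega> 0} (B (\<theta> t \<omega>)) \<le> ennreal (d / 3)) \<and>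
        likely (e / 2) (\<lambda>\<omega>. dist (pullback t \<omega> 0) (v \<omega>) \<le> d / 3)"
      using B de unfolding weak_point_attractor_def tendsto_0_in_prob_iff
      by (intro eventually_conj v_limit) auto
    then obtain t where t: "likely (e / 2) (\<lambda>\<omega>. semidist {\<phi> t \<omega> 0} (B (\<theta> t \<omega>)) \<le> ennreal (d / 3))"
      "likely (e / 2) (\<lambda>\<omega>. dist (pullback t \<omega> 0) (v \<omega>) \<le> d / 3)"
      using eventually_happens'[OF trivial_limit_at_top_linorder] by blast
    from likely_shift[OF t(1), of "- t"] t(2) show ?thesis
    proof (rule likely_conj')
      fix \<omega> assume \<omega>: "\<omega> \<in> space M"
        and "semidist {\<phi> t (\<theta> (- t) \<omega>) 0} (B (\<theta> t (\<theta> (- t) \<omega>))) \<le> ennreal (d / 3)"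
        and near: "dist (pullback t \<omega> 0) (v \<omega>) \<le> d / 3"
      then have "(INF b\<in>B \<omega>. ennreal (dist (pullback t \<omega> 0) b)) \<le> ennreal (d / 3)"
        by (simp add: semidist_def pullback_def \<theta>_minus)
      \<comment> \<open>The infimum may not be attained; the strictly larger bound yields an actual
        point \<open>b\<close>, and \<open>d / 3 + d / 2\<close> is still below
        \<open>d\<close>.\<close>
      also have "\<dots> < ennreal (d / 2)" using that by (simp add: ennreal_less_iff)
      finally obtain b where b: "b \<in> B \<omega>" "dist (pullback t \<omega> 0) b < d / 2"
        by (auto simp: INF_less_iff ennreal_less_iff)
      then have "dist (v \<omega>) b < d"
        using near dist_triangle3[of "v \<omega>" b "pullback t \<omega> 0"] that by simp
      then show "\<exists>b\<in>B \<omega>. dist (v \<omega>) b < d" using b by blast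
    qed
  qed
  then have "AE \<omega> in M. \<forall>n. \<exists>b\<in>B \<omega>. dist (v \<omega>) b < inverse (real (Suc n))"
    unfolding AE_all_countable by (intro allI AE_if_likely) auto
  moreover have "AE \<omega> in M. closed (B \<omega>)"
    using B unfolding weak_point_attractor_def invariant_compact_random_set_def random_closed_set_def
    by blast
  ultimately show ?thesis
  proof eventually_elim
    case (elim \<omega>)
    have "v \<omega> \<in> closure (B \<omega>)"
      unfolding closure_approachable
    proof (intro allI impI)
      fix r :: real assume "r > 0"
      then obtain n where "inverse (real (Suc n)) < r" using reals_Archimedean by blast
      then show "\<exists>b\<in>B \<omega>. dist b (v \<omega>) < r"
        using elim(1) by (metis dist_commute less_trans)
    qed
    then show ?case using elim(2) by (simp add: closure_closed)
  qed
qed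

end

text \<open>Degenerate intervals are singletons, by antisymmetry of the order. Minimality among
  interval attractors thus reduces to the case of point attractors.\<close>

lemma interval_attractor_imp_point_attractor:
  assumes "weak_interval_attractor C M \<theta> \<phi> B" shows "weak_point_attractor M \<theta> \<phi> B"
  unfolding weak_point_attractor_def
proof (intro conjI allI)
  show "invariant_compact_random_set M \<theta> \<phi> B"
    using assms unfolding weak_interval_attractor_def by blast
  fix x
  have "tendsto_0_in_prob M (\<lambda>t \<omega>. semidist (\<phi> t \<omega> ` interval x x) (B (\<theta> t \<omega>)))"
    using assms le_refl unfolding weak_interval_attractor_def by blast
  then show "tendsto_0_in_prob M (\<lambda>t \<omega>. semidist {\<phi> t \<omega> x} (B (\<theta> t \<omega>)))"
    by (simp add: interval_same)
qed

end

section \<open>Uniqueness of minimal random sets and the conclusion\<close>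

lemma unique_minimal_random_setI:
  assumes "Q A" "\<And>B. Q B \<Longrightarrow> AE \<omega> in M. A \<omega> \<subseteq> B \<omega>"
  shows "unique_minimal_random_set M Q A"
  unfolding unique_minimal_random_set_def minimal_random_set_def
proof (intro conjI allI impI assms)
  fix B assume B: "Q B \<and> (\<forall>A. Q A \<longrightarrow> (AE \<omega> in M. B \<omega> \<subseteq> A \<omega>))"
  then have "AE \<omega> in M. B \<omega> \<subseteq> A \<omega>" "AE \<omega> in M. A \<omega> \<subseteq> B \<omega>" using assms by auto
  then show "AE \<omega> in M. B \<omega> = A \<omega>" by eventually_elim auto
qed

theorem theorem3p11:
  fixes M :: "'w measure"
    and \<theta> :: "real \<Rightarrow> 'w \<Rightarrow> 'w"
    and \<phi> :: "real \<Rightarrow> 'w \<Rightarrow> 'h::{real_inner, banach, second_countable_topology} \<Rightarrow> 'h"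
    and C :: "'h set"
    and \<iota> :: "'v::banach \<Rightarrow> 'h"
    and \<mu> :: "'h measure"
  assumes "ordered_hilbert_space C \<iota>"
    and "random_dynamical_system M \<theta> \<phi>"
    and "order_preserving C M \<phi>"
    and "strongly_mixing M \<phi> \<mu>"
    and "AE x in \<mu>. x \<in> range \<iota>"
  shows "\<exists>v \<in> borel_measurable M.
           (AE \<omega> in M. v \<omega> \<in> range \<iota>) \<and>
           unique_minimal_random_set M (weak_point_attractor M \<theta> \<phi>) (\<lambda>\<omega>. {v \<omega>}) \<and>
           unique_minimal_random_set M (weak_interval_attractor C M \<theta> \<phi>) (\<lambda>\<omega>. {v \<omega>})"
proof -
  interpret ordered_hilbert_space C \<iota> by fact
  interpret monotone_mixing_rds M \<theta> \<phi> C \<mu>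
  proof (intro monotone_mixing_rds.intro monotone_mixing_rds_axioms.intro)
    show "normal_ordered_space C" by unfold_locales
    show "\<exists>a b. measure \<mu> (interval a b) > 1 - e" if "e > 0" for e
      using interval_mass[OF _ _ assms(5) that] assms(4) unfolding strongly_mixing_def by blast
  qed (fact assms)+
  obtain v where v: "v \<in> borel_measurable M"
    "\<And>x d e. d > 0 \<Longrightarrow> e > 0 \<Longrightarrow> \<forall>\<^sub>F t in at_top. likely e (\<lambda>\<omega>. dist (pullback t \<omega> x) (v \<omega>) \<le> d)"
    using pullback_limit by blast
  show ?thesis
  proof (intro bexI[of _ v] conjI unique_minimal_random_setI)
    show "AE \<omega> in M. v \<omega> \<in> range \<iota>" using limit_concentrated[OF v assms(5)] .
    show "weak_point_attractor M \<theta> \<phi> (\<lambda>\<omega>. {v \<omega>})" using limit_point_attractor[OF v] .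
    show "weak_interval_attractor C M \<theta> \<phi> (\<lambda>\<omega>. {v \<omega>})" using limit_interval_attractor[OF v] .
    show "AE \<omega> in M. {v \<omega>} \<subseteq> B \<omega>" if "weak_point_attractor M \<theta> \<phi> B" for B
      using limit_in_point_attractor[OF v that] by simp
    show "AE \<omega> in M. {v \<omega>} \<subseteq> B \<omega>" if "weak_interval_attractor C M \<theta> \<phi> B" for B
      using limit_in_point_attractor[OF v interval_attractor_imp_point_attractor[OF that]] by simp
  qed (rule v)
qed

end
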